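(* Let $s$ be an odd positive integer, $s=2M+1$ with $M\ge0$ an integer, and let $(a_n)_{n=0}^\infty$ be a greedy $s$-energy sequence on $S^1$. Then for all $N\ge1$ \[ \begin{aligned} U_{N,s}(a_N)={}&\frac{(\frac12)_M}{\pi\,2^{2M}M!}\,N\log N+\frac{(\frac12)_M}{\pi\,2^{2M}M!}\left(\gamma+\log(4/\pi)+C_M+\Lambda(\eta(N))\right)N\\ &+\frac{2}{(2\pi)^s}\sum_{j=0}^{M-1}\alpha_j(s)\,\zeta(s-2j)\,(2^{s-2j}-1)\,G(\eta(N);s-2j)\,N^{s-2j}+H_{N,s}, \end{aligned} \] where the sequence $(H_{N,s})_{N=1}^\infty$ is uniformly bounded in $N$.
   Context: $S^1$ is the unit circle in $\mathbb{C}$. For $s>0$ let $K_s(x,y):=|x-y|^{-s}$ (with value $+\infty$ if $x=y$). A greedy $s$-energy sequence is a sequence $(a_n)_{n=0}^\infty\subset S^1$ with $a_0\in S^1$ arbitrary and, for each $n\ge1$, $a_n$ any point satisfying $\sum_{\ell=0}^{n-1}K_s(a_n,a_\ell)=\min_{x\in S^1}\sum_{\ell=0}^{n-1}K_s(x,a_\ell)$. Put $U_{N,s}(x):=\sum_{k=0}^{N-1}|x-a_k|^{-s}$. Write $N\in\mathbb{N}=\{1,2,\ldots\}$ in binary as $N=2^{n_1}+\cdots+2^{n_p}$ with integers $n_1>\cdots>n_p\ge 0$, and set $\eta(N):=\left(\frac{2^{n_1}}{N},\ldots,\frac{2^{n_p}}{N}\right)$. For a vector $\vec\theta=(\theta_1,\ldots,\theta_p)$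 with positive components, $G(\vec\theta;t):=\sum_{k=1}^p\theta_k^t$ and $\Lambda(\vec\theta):=\sum_{k=1}^p\theta_k\log\theta_k$. Let $\mathrm{sinc}\,z:=(\sin\pi z)/(\pi z)$ for $z\ne0$ and $\mathrm{sinc}\,0:=1$. For $s\in\mathbb{C}$, $|z|<1$, $\mathrm{sinc}^{-s}z:=\exp(-s\log\mathrm{sinc}\,z)$ with the analytic branch of $\log\mathrm{sinc}\,z$ vanishing at $z=0$; the coefficients $\alpha_n(s)$, $n\ge0$, are defined by $\mathrm{sinc}^{-s}z=\sum_{n=0}^\infty\alpha_n(s)z^{2n}$, $|z|<1$. For an integer $M\ge0$, \[ C_M:=\frac{\alpha_M'(2M+1)}{\alpha_M(2M+1)}+\frac12\psi(M+1)-\frac12\psi(M+1/2), \] where $\psi=\Gamma'/\Gamma$ is the Digamma function and $\alpha_M'(2M+1)$ is the derivative of $s\mapsto\alpha_M(s)$ at $s=2M+1$. $\zeta$ is the Riemann zeta function, $\gamma$ the Euler–Mascheroni constant, $(x)_n$ the Pochhammer symbol $x(x+1)\cdots(x+n-1)$ (with $(x)_0=1$). A sum $\sum_{j=J}^{J'}$ with $J'<J$ is interpreted as $0$. *)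

theory Defs
  imports
    "HOL-Complex_Analysis.Complex_Analysis"
    "HOL-Library.Nat_Bijection"
begin

section \<open>Greedy energy sequences on the unit circle\<close>

definition riesz_kernel :: "real \<Rightarrow> complex \<Rightarrow> complex \<Rightarrow> ereal" where
  "riesz_kernel s x y = (if x = y then \<infinity> else ereal (cmod (x - y) powr (- s)))"

definition potential :: "real \<Rightarrow> (nat \<Rightarrow> complex) \<Rightarrow> nat \<Rightarrow> complex \<Rightarrow> ereal" where
  "potential s a N x = (\<Sum>k<N. riesz_kernel s x (a k))"

definition greedy_energy_sequence :: "real \<Rightarrow> (nat \<Rightarrow> complex) \<Rightarrow> bool" where
  "greedy_energy_sequence s a \<longleftrightarrow>
     (\<forall>n. a n \<in> sphere 0 1) \<and>
     (\<forall>n\<ge>1. \<forall>x\<in>sphere 0 1. potential s a n (a n) \<le> potential s a n x)"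


section \<open>Binary expansions\<close>

definition binary_exponents :: "nat \<Rightarrow> nat list" where
  "binary_exponents N = rev (sorted_list_of_set (set_decode N))"

lemma sorted_binary_exponents: "sorted_wrt (>) (binary_exponents N)"
  by (simp add: binary_exponents_def sorted_wrt_rev)

lemma sum_binary_exponents: "sum_list (map (\<lambda>n. 2 ^ n) (binary_exponents N)) = N"
proof -
  have "sum_list (map (\<lambda>n. 2 ^ n) (binary_exponents N)) = (\<Sum>n\<in>set_decode N. 2 ^ n)"
    by (simp add: binary_exponents_def rev_map[symmetric] sum_list_distinct_conv_sum_set)
  also have "\<dots> = set_encode (set_decode N)"
    unfolding set_encode_def ..
  finally show ?thesis by simp
qed

definition eta :: "nat \<Rightarrow> real list" where
  "eta N = map (\<lambda>n. 2 ^ n / real N) (binary_exponents N)"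

definition G :: "real list \<Rightarrow> real \<Rightarrow> real" where
  "G \<theta> t = (\<Sum>x\<leftarrow>\<theta>. x powr t)"

definition Lam :: "real list \<Rightarrow> real" where
  "Lam \<theta> = (\<Sum>x\<leftarrow>\<theta>. x * ln x)"


section \<open>Coefficients of powers of the sinc function\<close>

definition sinc_pi :: "complex \<Rightarrow> complex" where
  "sinc_pi z = (if z = 0 then 1 else sin (of_real pi * z) / (of_real pi * z))"

text \<open>Only the values on the open unit disc are meaningful; there they are uniquely
  determined, see \<open>log_sinc_unique\<close>.\<close>

definition log_sinc :: "complex \<Rightarrow> complex" where
  "log_sinc = (SOME f. f holomorphic_on ball 0 1 \<and> f 0 = 0 \<and>
                       (\<forall>z\<in>ball 0 1. exp (f z) = sinc_pi z))"

definition sinc_neg_power :: "complex \<Rightarrow> complex \<Rightarrow> complex" where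
  "sinc_neg_power s z = exp (- s * log_sinc z)"

definition alpha :: "nat \<Rightarrow> complex \<Rightarrow> complex" where
  "alpha n s = (THE c. \<forall>z\<in>ball 0 1. (\<lambda>k. c k * z ^ (2 * k)) sums sinc_neg_power s z) n"

lemma sinc_pi_holomorphic: "sinc_pi holomorphic_on UNIV"
proof -
  have 1: "(\<lambda>z. sin (of_real pi * z)) holomorphic_on UNIV"
    by (intro holomorphic_intros)
  have 2: "((\<lambda>z. sin (of_real pi * z)) has_field_derivative of_real pi) (at 0)"
    by (auto intro!: derivative_eq_intros)
  have 3: "(\<lambda>z. if z = 0 then deriv (\<lambda>z. sin (of_real pi * z)) 0
               else (sin (of_real pi * z) - sin (of_real pi * 0)) / (z - 0)) holomorphic_on UNIV"
    by (rule pole_theorem_open_0[where g = "\<lambda>z. sin (of_real pi * z)", OF 1]) auto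
  have "(\<lambda>z. (if z = 0 then deriv (\<lambda>z. sin (of_real pi * z)) 0
               else (sin (of_real pi * z) - sin (of_real pi * 0)) / (z - 0)) / of_real pi)
          holomorphic_on UNIV"
    by (intro holomorphic_intros 3) auto
  also have "(\<lambda>z. (if z = 0 then deriv (\<lambda>z. sin (of_real pi * z)) 0
               else (sin (of_real pi * z) - sin (of_real pi * 0)) / (z - 0)) / of_real pi) = sinc_pi"
    using DERIV_imp_deriv[OF 2] by (auto simp: fun_eq_iff sinc_pi_def)
  finally show ?thesis .
qed

lemma sinc_pi_nonzero:
  assumes "z \<in> ball 0 1"
  shows "sinc_pi z \<noteq> 0"
proof
  assume *: "sinc_pi z = 0"
  then have z: "z \<noteq> 0" and "sin (of_real pi * z) = 0"
    by (auto simp: sinc_pi_def split: if_splits)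
  then obtain n :: int where "of_real pi * z = of_real (of_int n * pi)"
    unfolding sin_eq_0 by auto
  then have zn: "z = of_int n" by auto
  with assms z show False by (auto simp: zn)
qed

lemma log_sinc:
  shows log_sinc_holomorphic: "log_sinc holomorphic_on ball 0 1"
    and log_sinc_0: "log_sinc 0 = 0"
    and exp_log_sinc: "z \<in> ball 0 1 \<Longrightarrow> exp (log_sinc z) = sinc_pi z"
proof -
  obtain g where g: "g holomorphic_on ball 0 1" "\<And>z. z \<in> ball 0 1 \<Longrightarrow> sinc_pi z = exp (g z)"
    using contractible_imp_holomorphic_log
      [OF holomorphic_on_subset[OF sinc_pi_holomorphic] convex_imp_contractible]
      sinc_pi_nonzero convex_ball by (metis subset_UNIV)
  have "exp (g 0) = 1"
    using g(2)[of 0] by (simp add: sinc_pi_def)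
  then have "\<exists>f. f holomorphic_on ball 0 1 \<and> f 0 = 0 \<and> (\<forall>z\<in>ball 0 1. exp (f z) = sinc_pi z)"
    using g by (intro exI[of _ "\<lambda>z. g z - g 0"]) (auto intro!: holomorphic_intros simp: exp_diff)
  from someI_ex[OF this] show "log_sinc holomorphic_on ball 0 1" "log_sinc 0 = 0"
    "z \<in> ball 0 1 \<Longrightarrow> exp (log_sinc z) = sinc_pi z"
    unfolding log_sinc_def by blast+
qed

lemma log_sinc_unique:
  assumes f: "f holomorphic_on ball 0 1" "f 0 = 0" "\<And>z. z \<in> ball 0 1 \<Longrightarrow> exp (f z) = sinc_pi z"
    and z: "z \<in> ball 0 1"
  shows "f z = log_sinc z"
proof -
  have d: "((\<lambda>w. f w - log_sinc w) has_field_derivative 0) (at w within ball 0 1)"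
    if w: "w \<in> ball 0 1" for w
  proof -
    have A: "(h has_field_derivative deriv sinc_pi w / sinc_pi w) (at w)"
      if h: "h holomorphic_on ball 0 1" "\<And>z. z \<in> ball 0 1 \<Longrightarrow> exp (h z) = sinc_pi z" for h
    proof -
      have h': "(h has_field_derivative deriv h w) (at w)"
        using holomorphic_derivI[OF h(1) open_ball w] .
      have "((\<lambda>x. exp (h x)) has_field_derivative exp (h w) * deriv h w) (at w)"
        by (rule DERIV_fun_exp[OF h'])
      then have "(sinc_pi has_field_derivative exp (h w) * deriv h w) (at w)"
        by (rule has_field_derivative_transform_within_open[OF _ open_ball w]) (rule h(2))
      then have "deriv sinc_pi w = sinc_pi w * deriv h w"
        using h(2)[OF w] by (simp add: DERIV_imp_deriv)
      with h' sinc_pi_nonzero[OF w] show ?thesis by simp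
    qed
    show ?thesis
      using DERIV_diff[OF A[OF f(1,3)] A[OF log_sinc_holomorphic exp_log_sinc]]
      by (auto intro: has_field_derivative_at_within)
  qed
  have "f z - log_sinc z = f 0 - log_sinc 0"
    using has_field_derivative_zero_constant[OF convex_ball d] z
    by (metis centre_in_ball zero_less_one)
  then show ?thesis by (simp add: f(2) log_sinc_0)
qed

lemma log_sinc_minus:
  assumes "z \<in> ball 0 1"
  shows "log_sinc (- z) = log_sinc z"
proof (rule log_sinc_unique[where f = "\<lambda>z. log_sinc (- z)"])
  show "(\<lambda>z. log_sinc (- z)) holomorphic_on ball 0 1"
  proof -
    have "uminus ` ball (0::complex) 1 \<subseteq> ball 0 1" by auto
    from holomorphic_on_compose_gen[OF holomorphic_on_minus[OF holomorphic_on_ident]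
      log_sinc_holomorphic this] show ?thesis by (simp add: o_def)
  qed
qed (use assms in \<open>auto simp: log_sinc_0 exp_log_sinc sinc_pi_def\<close>)

lemma even_power_series_unique:
  fixes c d :: "nat \<Rightarrow> complex"
  assumes c: "\<And>z. z \<in> ball 0 1 \<Longrightarrow> (\<lambda>k. c k * z ^ (2 * k)) sums f z"
    and d: "\<And>z. z \<in> ball 0 1 \<Longrightarrow> (\<lambda>k. d k * z ^ (2 * k)) sums f z"
  shows "c = d"
proof -
  have "(\<lambda>k. (c k - d k) * w ^ k) sums 0" if "norm w < 1" for w
  proof -
    have "norm (csqrt w) ^ 2 < 1"
      using that by (metis norm_power power2_csqrt)
    then have "csqrt w \<in> ball 0 1"
      by (simp add: power2_eq_square power_less_one_iff abs_square_less_1[unfolded power2_eq_square])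
    from sums_diff[OF c[OF this] d[OF this]] show ?thesis
      by (simp add: power_mult left_diff_distrib)
  qed
  note S = this
  have "c n - d n = 0" for n
  proof (rule ccontr)
    assume nz: "c n - d n \<noteq> 0"
    have "c 0 - d 0 = 0"
      using sums_unique2[OF S[of 0] powser_sums_zero[of "\<lambda>k. c k - d k"]] by simp
    with nz have "n > 0" by (cases n) auto
    obtain r where r: "0 < r" "\<And>z. z \<in> cball 0 r - {0::complex} \<Longrightarrow> (0::complex) \<noteq> 0"
      using powser_0_nonzero[of 1 0 "\<lambda>k. c k - d k" "\<lambda>_. 0" n] S nz \<open>n > 0\<close> by auto
    show False
      using r(2)[of "of_real r"] r(1) by simp
  qed
  then show ?thesis by auto
qed

lemma alpha_sums:
  assumes "z \<in> ball 0 1"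
  shows "(\<lambda>n. alpha n s * z ^ (2 * n)) sums sinc_neg_power s z"
proof -
  let ?f = "sinc_neg_power s"
  have hol: "?f holomorphic_on ball 0 1"
    unfolding sinc_neg_power_def by (intro holomorphic_intros log_sinc_holomorphic)
  define b where "b n = (deriv ^^ n) ?f 0 / fact n" for n
  have b: "(\<lambda>n. b n * z ^ n) sums ?f z" if "z \<in> ball 0 1" for z
    using holomorphic_power_series[OF hol that] by (simp add: b_def)
  have even: "(\<lambda>n. b (2 * n) * z ^ (2 * n)) sums ?f z" if z: "z \<in> ball 0 1" for z
  proof -
    have "- z \<in> ball 0 1" using z by simp
    from sums_add[OF b[OF z] b[OF this]]
    have "(\<lambda>n. b n * z ^ n + b n * (- z) ^ n) sums (2 * ?f z)"
      using log_sinc_minus[OF z] by (simp add: sinc_neg_power_def)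
    then have "(\<lambda>n. (b n * z ^ n + b n * (- z) ^ n) / 2) sums (?f z)"
      using sums_divide[where c = 2] by fastforce
    moreover have "(b n * z ^ n + b n * (- z) ^ n) / 2 = 0" if "n \<notin> range (\<lambda>n. 2 * n)" for n
    proof -
      from that have "odd n" by (auto elim!: evenE)
      then show ?thesis by simp
    qed
    ultimately have "(\<lambda>n. (b (2 * n) * z ^ (2 * n) + b (2 * n) * (- z) ^ (2 * n)) / 2) sums ?f z"
      by (subst sums_mono_reindex[of "\<lambda>n. 2 * n"]) (auto simp: strict_mono_def)
    then show ?thesis by simp
  qed
  have "(THE c. \<forall>z\<in>ball 0 1. (\<lambda>k. c k * z ^ (2 * k)) sums ?f z) = (\<lambda>n. b (2 * n))"
    using even by (intro the_equality) (auto intro!: even_power_series_unique[of _ ?f])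
  with even[OF assms] show ?thesis
    by (simp add: alpha_def)
qed

section \<open>Constants\<close>

definition C :: "nat \<Rightarrow> complex" where
  "C M = deriv (alpha M) (of_nat (2 * M + 1)) / alpha M (of_nat (2 * M + 1))
         + Digamma (of_nat M + 1) / 2 - Digamma (of_nat M + 1 / 2) / 2"

text \<open>The Riemann zeta function on the half-plane \<open>Re s > 1\<close>, where it is given by its
  Dirichlet series. It is only used at the odd integers \<open>3, 5, 7, \<dots>\<close>.\<close>

definition zeta :: "complex \<Rightarrow> complex" where
  "zeta s = (\<Sum>n. 1 / of_nat (Suc n) powr s)"

end

theory Submission
  imports Defs
begin

text \<open>The proof rests on three facts.

\<^item> \<^bold>\<open>Structure.\<close> The potential of the \<open>m\<close>-th roots of a point of the circle is minimal exactly at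
  the \<open>m\<close> midpoints between neighbouring roots, by strict convexity. By induction on \<open>n\<close>, the
  first \<open>2^n\<close> points of a greedy sequence are therefore a coset of the \<open>2^n\<close>-th roots of unity, and
  the following points form again a greedy sequence, inside the coset of the midpoints: a minimizer of
  their own potential lies in that coset, where it also minimizes the potential of the first block.
  Hence \<open>potential s a N (a N)\<close> is the sum, over the binary digits \<open>2^i\<close> of \<open>N\<close>, of the value
  \<open>midpoint_energy s (2^i)\<close> at a midpoint (\<open>greedy_potential_eq\<close>).

\<^item> \<^bold>\<open>Asymptotics.\<close> For even \<open>m\<close>, \<open>midpoint_energy s m\<close> is twice the sum of \<open>(2 sin (\<pi> y))\<^sup>-\<^sup>s\<close> over
  the midpoints \<open>y\<close> of a partition of \<open>[0, 1/2]\<close> into \<open>m/2\<close> intervals. Here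
  \<open>(2 sin (\<pi> y))\<^sup>-\<^sup>s = (2 \<pi>)\<^sup>-\<^sup>s (\<Sum>n. \<alpha>\<^sub>n(s) y^(2 n - s))\<close>.
  The terms with \<open>n < M\<close> give odd power sums, that is, zeta values and a tail; \<open>n = M\<close> gives the odd
  harmonic sum and hence the logarithm; the remaining terms form a smooth function, to which the midpoint
  rule applies. All errors are \<open>O(1/m)\<close>, so that their sum over the binary digits is bounded.

\<^item> \<^bold>\<open>The constant.\<close> The coefficient of \<open>m\<close> contains the Hadamard finite part of the integral of
  \<open>(\<pi> / sin (\<pi> y))^(2 M + 1)\<close> over \<open>[0, 1/2]\<close>, which has to be \<open>\<alpha>\<^sub>M(2 M + 1) (C M - ln \<pi>)\<close>
  (\<open>finite_part_eq\<close>). This is proved by induction on \<open>M\<close>. Let \<open>g\<^sub>s(y) = (\<pi> / sin (\<pi> y))\<^sup>s\<close>. The equation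
  \<open>g\<^sub>s'' = s (s + 1) g\<^sub>s\<^sub>+\<^sub>2 - \<pi>\<^sup>2 s\<^sup>2 g\<^sub>s\<close> relates the finite parts for \<open>s\<close> and \<open>s + 2\<close>, up to a
  term \<open>\<alpha>\<^sub>M\<^sub>+\<^sub>1(2 M + 1)\<close>. Read coefficientwise, the same equation is a recurrence for \<open>\<alpha>\<^sub>n(s)\<close>, and its
  derivative in \<open>s\<close> expresses that extra term by the derivatives of \<open>\<alpha>\<^sub>M\<close> and \<open>\<alpha>\<^sub>M\<^sub>+\<^sub>1\<close> that
  enter \<open>C M\<close> and \<open>C (M + 1)\<close>.\<close>

section \<open>Equally spaced points on the circle\<close>

text \<open>The potential of \<open>m\<close> equally spaced points of the circle at a midpoint between two neighbours.\<close>

definition midpoint_energy :: "real \<Rightarrow> nat \<Rightarrow> real" where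
  "midpoint_energy s m = (\<Sum>j<m. (2 * sin (pi * (2 * real j + 1) / (2 * real m))) powr (- s))"

definition coset_potential :: "real \<Rightarrow> nat \<Rightarrow> complex \<Rightarrow> complex \<Rightarrow> ereal" where
  "coset_potential s m w x = (\<Sum>z | z ^ m = w. riesz_kernel s x z)"

text \<open>Strict midpoint convexity of \<open>x \<mapsto> (2 sin x)\<^sup>-\<^sup>s\<close> on \<open>(0, \<pi>)\<close>: the arithmetic mean of the two values
  dominates their geometric mean, and \<open>sin a sin b = (cos (a - b) - cos (a + b)) / 2\<close> is less than
  \<open>(1 - cos (a + b)) / 2 = sin\<^sup>2 ((a + b) / 2)\<close>.\<close>

lemma sin_midpoint_convexity:
  fixes a b s :: real
  assumes s: "s > 0" and a: "0 < a" "a < pi" and b: "0 < b" "b < pi" and "a \<noteq> b"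
  shows "2 * (2 * sin ((a + b) / 2)) powr (- s) < (2 * sin a) powr (- s) + (2 * sin b) powr (- s)"
proof -
  define c where "c = sin ((a + b) / 2)"
  have pos: "sin a > 0" "sin b > 0" "c > 0"
    using a b by (auto intro!: sin_gt_zero simp: c_def)
  have cos_less_1: "cos x < 1" if "0 < x" "x \<le> pi" for x :: real
    using cos_monotone_0_pi[of 0 x] that unfolding cos_zero by blast
  have cos_less: "cos (a - b) < 1"
  proof (cases "a < b")
    case True
    then have "cos (b - a) < 1"
      using a b by (intro cos_less_1) linarith+
    then show ?thesis
      using cos_minus[of "a - b"] unfolding minus_diff_eq by linarith
  next
    case False
    then show ?thesis
      using a b \<open>a \<noteq> b\<close> by (intro cos_less_1) linarith+
  qed
  have double: "2 * ((a + b) / 2) = a + b" by simp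
  have cos_add: "cos (a + b) = 1 - 2 * c\<^sup>2"
    using cos_double_sin[of "(a + b) / 2"] unfolding c_def double .
  have less: "sin a * sin b < c\<^sup>2"
  proof -
    have "sin a * sin b = (cos (a - b) - (1 - 2 * c\<^sup>2)) / 2"
      unfolding sin_times_sin cos_add ..
    also have "\<dots> < (1 - (1 - 2 * c\<^sup>2)) / 2"
      using cos_less by (intro divide_strict_right_mono diff_strict_right_mono) simp_all
    finally show ?thesis by simp
  qed
  define p where "p = (2 * sin a) powr (- s / 2)"
  define q where "q = (2 * sin b) powr (- s / 2)"
  have half: "x powr (- s) = x powr (- s / 2) * x powr (- s / 2)" for x :: real
  proof -
    have "- s = - s / 2 + - s / 2" by simp
    then show ?thesis by (metis powr_add)
  qed
  have "(2 * c) powr (- s) = (2 * c * (2 * c)) powr (- s / 2)"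
    unfolding half by (rule powr_mult[symmetric])
  also have "\<dots> < (2 * sin a * (2 * sin b)) powr (- s / 2)"
    by (rule powr_less_mono2_neg) (use s pos less in \<open>simp_all add: power2_eq_square\<close>)
  also have "\<dots> = p * q"
    unfolding p_def q_def by (rule powr_mult)
  finally have 1: "(2 * c) powr (- s) < p * q" .
  have "2 * (p * q) \<le> p * p + q * q"
    using sum_squares_bound[of p q] by (simp only: mult.assoc power2_eq_square)
  also have "\<dots> = (2 * sin a) powr (- s) + (2 * sin b) powr (- s)"
    unfolding half p_def q_def ..
  finally show ?thesis
    using 1 unfolding c_def by linarith
qed

text \<open>The sum is the potential of \<open>m\<close> equally spaced points, seen from a point at angular distance \<open>2 u\<close> from one of them.
  Reflection about the midpoint replaces \<open>u\<close> by \<open>\<pi>/m - u\<close> and permutes the terms; convexity applied to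
  the pairs of terms with equal index then yields the minimum at the fixed point of the reflection.\<close>

lemma shifted_sum_ge_midpoint_energy:
  fixes s u :: real and m :: nat
  defines "S \<equiv> \<lambda>u. \<Sum>j<m. (2 * sin (u + pi * real j / real m)) powr (- s)"
  assumes s: "s > 0" and m: "m > 0" and u: "0 < u" "u < pi / real m"
  shows "midpoint_energy s m \<le> S u" and "S u = midpoint_energy s m \<longleftrightarrow> u = pi / (2 * real m)"
proof -
  have refl: "S (pi / real m - u) = S u"
  proof -
    have "S (pi / real m - u) = (\<Sum>j<m. (2 * sin (pi / real m - u + pi * real (m - Suc j) / real m)) powr (- s))"
      unfolding S_def by (rule sum.nat_diff_reindex[symmetric])
    also have "\<dots> = S u"
      unfolding S_def
    proof (rule sum.cong)
      fix j assume "j \<in> {..<m}"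
      then have "pi / real m - u + pi * real (m - Suc j) / real m = pi - (u + pi * real j / real m)"
        using m by (simp add: of_nat_diff field_simps)
      then show "(2 * sin (pi / real m - u + pi * real (m - Suc j) / real m)) powr (- s) =
          (2 * sin (u + pi * real j / real m)) powr (- s)"
        by (simp only: sin_pi_minus)
    qed simp
    finally show ?thesis .
  qed
  have mid: "S (pi / (2 * real m)) = midpoint_energy s m"
    unfolding S_def midpoint_energy_def using m by (simp add: field_simps)
  have strict: "midpoint_energy s m < S u" if ne: "u \<noteq> pi / (2 * real m)"
  proof -
    have "2 * midpoint_energy s m = (\<Sum>j<m. 2 * (2 * sin (pi / (2 * real m) + pi * real j / real m)) powr (- s))"
      by (simp add: S_def sum_distrib_left flip: mid)
    also have "\<dots> < (\<Sum>j<m. (2 * sin (u + pi * real j / real m)) powr (- s)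
        + (2 * sin (pi / real m - u + pi * real j / real m)) powr (- s))"
    proof (rule sum_strict_mono)
      fix j assume j: "j \<in> {..<m}"
      have "(real j + 1) * (pi / real m) \<le> real m * (pi / real m)"
        using j by (intro mult_right_mono) auto
      then have le: "pi / real m + pi * real j / real m \<le> pi"
        using m by (simp add: algebra_simps add_divide_distrib)
      have v: "0 \<le> pi * real j / real m" by simp
      have ne': "2 * u \<noteq> pi / real m" using ne by auto
      have "2 * (2 * sin ((u + pi * real j / real m + (pi / real m - u + pi * real j / real m)) / 2)) powr (- s)
          < (2 * sin (u + pi * real j / real m)) powr (- s)
             + (2 * sin (pi / real m - u + pi * real j / real m)) powr (- s)"
        by (intro sin_midpoint_convexity s) (use le u v ne' in linarith)+
      moreover have "(u + pi * real j / real m + (pi / real m - u + pi * real j / real m)) / 2 =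
          pi / (2 * real m) + pi * real j / real m"
        by simp
      ultimately show "2 * (2 * sin (pi / (2 * real m) + pi * real j / real m)) powr (- s)
          < (2 * sin (u + pi * real j / real m)) powr (- s)
             + (2 * sin (pi / real m - u + pi * real j / real m)) powr (- s)" by (simp only:)
    qed (use m in auto)
    also have "\<dots> = S u + S (pi / real m - u)"
      by (simp add: S_def sum.distrib)
    finally show ?thesis unfolding refl by simp
  qed
  show "midpoint_energy s m \<le> S u"
    using strict mid by (cases "u = pi / (2 * real m)") auto
  show "S u = midpoint_energy s m \<longleftrightarrow> u = pi / (2 * real m)"
    using strict mid by force
qed

lemma finite_roots: "m > 0 \<Longrightarrow> finite {z::complex. z ^ m = w}"
  by (rule finite_nth_roots) simp

lemma coset_potential_on_coset:
  assumes "m > 0" "x ^ m = w"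
  shows "coset_potential s m w x = \<infinity>"
proof -
  have "coset_potential s m w x = riesz_kernel s x x + (\<Sum>z\<in>{z. z ^ m = w} - {x}. riesz_kernel s x z)"
    unfolding coset_potential_def using assms by (intro sum.remove finite_roots) auto
  moreover have "(\<Sum>z\<in>{z. z ^ m = w} - {x}. riesz_kernel s x z) \<ge> 0"
    by (intro sum_nonneg) (auto simp: riesz_kernel_def)
  ultimately show ?thesis
    by (auto simp: riesz_kernel_def)
qed

text \<open>With \<open>w / x ^ m = cis \<theta>\<close> and \<open>0 < \<theta> < 2 \<pi>\<close>, the first root met from \<open>x\<close> counterclockwise is at angle \<open>\<theta> / m\<close>, so that
  \<open>u = \<theta> / (2 m)\<close>; the midpoints are the points with \<open>\<theta> = \<pi>\<close>.\<close>

lemma coset_potential_off_coset: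
  fixes m :: nat
  assumes m: "m > 0" and x: "norm x = 1" and w: "norm w = 1" and ne: "x ^ m \<noteq> w"
  obtains u where "0 < u" "u < pi / real m" "u = pi / (2 * real m) \<longleftrightarrow> x ^ m = - w"
    "coset_potential s m w x = ereal (\<Sum>j<m. (2 * sin (u + pi * real j / real m)) powr (- s))"
proof -
  define \<theta> where "\<theta> = Arg2pi (w / x ^ m)"
  have "x \<noteq> 0" using x by auto
  have cis: "w / x ^ m = cis \<theta>"
    using Arg2pi_eq[of "w / x ^ m"] x w by (simp add: \<theta>_def norm_divide norm_power cis_conv_exp)
  have \<theta>: "0 < \<theta>" "\<theta> < 2 * pi"
  proof -
    have "\<theta> \<noteq> 0"
    proof
      assume "\<theta> = 0"
      with cis ne \<open>x \<noteq> 0\<close> show False by (simp add: field_simps)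
    qed
    then show "0 < \<theta>" "\<theta> < 2 * pi"
      using Arg2pi_ge_0[of "w / x ^ m"] Arg2pi_lt_2pi[of "w / x ^ m"] by (auto simp: \<theta>_def)
  qed
  define u where "u = \<theta> / (2 * real m)"
  define z0 where "z0 = x * cis (\<theta> / real m)"
  have u_less: "u < pi / real m"
    using \<theta> m by (simp add: u_def field_simps)
  have z0: "z0 ^ m = w"
  proof -
    have "cis (\<theta> / real m) ^ m = cis \<theta>"
      using m Complex.DeMoivre[of "\<theta> / real m" m] by simp
    then show ?thesis
      using cis \<open>x \<noteq> 0\<close> by (simp add: z0_def power_mult_distrib field_simps)
  qed
  have bij: "bij_betw (\<lambda>j. z0 * cis (2 * pi * real j / real m)) {..<m} {z. z ^ m = w}"
  proof -
    have "z0 \<noteq> 0" using \<open>x \<noteq> 0\<close> by (simp add: z0_def)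
    then have "bij_betw (\<lambda>z. z0 * z) {z. z ^ m = 1} {z. z ^ m = w}"
      using z0 by (intro bij_betwI[where g = "\<lambda>z. z / z0"]) (auto simp: power_mult_distrib power_divide)
    from bij_betw_trans[OF Complex.bij_betw_roots_unity[OF m] this] show ?thesis
      by (simp add: o_def)
  qed
  have kernel: "riesz_kernel s x (z0 * cis (2 * pi * real j / real m)) =
      ereal ((2 * sin (u + pi * real j / real m)) powr (- s))" if j: "j < m" for j
  proof -
    define t where "t = u + pi * real j / real m"
    have "(real j + 1) * (pi / real m) \<le> real m * (pi / real m)"
      using j by (intro mult_right_mono) auto
    then have "pi / real m + pi * real j / real m \<le> pi"
      using m by (simp add: algebra_simps add_divide_distrib)
    moreover have "0 \<le> pi * real j / real m" by simp
    moreover have "u > 0" using \<theta> m by (simp add: u_def)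
    ultimately have t: "0 < t" "t < pi"
      using u_less unfolding t_def by linarith+
    then have "sin t > 0" by (rule sin_gt_zero)
    have "z0 * cis (2 * pi * real j / real m) = x * cis (2 * t)"
    proof -
      have "\<theta> / real m + 2 * pi * real j / real m = 2 * t"
        using m by (simp add: t_def u_def)
      then show ?thesis
        by (simp only: z0_def mult.assoc cis_mult)
    qed
    moreover have "norm (x - x * cis (2 * t)) = 2 * sin t"
    proof -
      have "norm (x - x * cis (2 * t)) = norm (x * (cis (2 * t) - 1))"
        by (subst norm_minus_commute) (simp add: algebra_simps)
      also have "\<dots> = 2 * \<bar>sin t\<bar>"
        using dist_exp_i_1[of "2 * t"] x by (simp add: norm_mult cis_conv_exp)
      finally show ?thesis using \<open>sin t > 0\<close> by simp
    qed
    ultimately show ?thesis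
      using \<open>sin t > 0\<close> by (auto simp: riesz_kernel_def simp flip: t_def)
  qed
  have "coset_potential s m w x =
      (\<Sum>j<m. riesz_kernel s x (z0 * cis (2 * pi * real j / real m)))"
    unfolding coset_potential_def by (rule sum.reindex_bij_betw[OF bij, symmetric])
  also have "\<dots> = (\<Sum>j<m. ereal ((2 * sin (u + pi * real j / real m)) powr (- s)))"
    by (intro sum.cong kernel) auto
  finally have "coset_potential s m w x = ereal (\<Sum>j<m. (2 * sin (u + pi * real j / real m)) powr (- s))"
    by simp
  moreover have "u = pi / (2 * real m) \<longleftrightarrow> x ^ m = - w"
  proof -
    have "w = cis \<theta> * x ^ m"
      using cis \<open>x \<noteq> 0\<close> by (simp add: field_simps)
    then have "x ^ m = - w \<longleftrightarrow> (1 + cis \<theta>) * x ^ m = 0"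
      by (simp add: algebra_simps eq_neg_iff_add_eq_0)
    also have "\<dots> \<longleftrightarrow> cis \<theta> = - 1"
      using \<open>x \<noteq> 0\<close> by (simp add: add_eq_0_iff)
    also have "\<dots> \<longleftrightarrow> \<theta> = pi"
    proof
      assume "cis \<theta> = - 1"
      then have "cos \<theta> = - 1" by (simp add: complex_eq_iff)
      then show "\<theta> = pi"
        using \<theta> cos_monotone_0_pi[of \<theta> pi] cos_monotone_0_pi[of "2 * pi - \<theta>" pi]
        by (cases \<theta> pi rule: linorder_cases) (auto simp: cos_diff)
    qed simp
    also have "\<dots> \<longleftrightarrow> u = pi / (2 * real m)"
      using m by (simp add: u_def)
    finally show ?thesis ..
  qed
  ultimately show ?thesis
    using that[of u] \<theta> m u_less by (simp add: u_def)
qed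

lemma coset_potential_midpoint:
  assumes "s > 0" "m > 0" "norm x = 1" "norm w = 1" "x ^ m = - w"
  shows "coset_potential s m w x = ereal (midpoint_energy s m)"
proof -
  have "x ^ m \<noteq> w" using assms by auto
  then show ?thesis
    using coset_potential_off_coset[OF assms(2-4), of s] shifted_sum_ge_midpoint_energy(2)[OF assms(1,2)] assms(5)
    by metis
qed

lemma coset_potential_ge:
  assumes "s > 0" "m > 0" "norm x = 1" "norm w = 1"
  shows "ereal (midpoint_energy s m) \<le> coset_potential s m w x"
    and "coset_potential s m w x \<le> ereal (midpoint_energy s m) \<Longrightarrow> x ^ m = - w"
proof -
  have "ereal (midpoint_energy s m) \<le> coset_potential s m w x \<and>
    (coset_potential s m w x \<le> ereal (midpoint_energy s m) \<longrightarrow> x ^ m = - w)"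
  proof (cases "x ^ m = w")
    case True
    then show ?thesis using coset_potential_on_coset[OF assms(2)] by simp
  next
    case False
    obtain u where u: "0 < u" "u < pi / real m" "u = pi / (2 * real m) \<longleftrightarrow> x ^ m = - w"
      "coset_potential s m w x = ereal (\<Sum>j<m. (2 * sin (u + pi * real j / real m)) powr (- s))"
      using coset_potential_off_coset[OF assms(2-4) False] by metis
    show ?thesis
      unfolding u(4) using u(3) shifted_sum_ge_midpoint_energy[OF assms(1,2) u(1,2)] by auto
  qed
  then show "ereal (midpoint_energy s m) \<le> coset_potential s m w x"
    "coset_potential s m w x \<le> ereal (midpoint_energy s m) \<Longrightarrow> x ^ m = - w" by blast+
qed



section \<open>Greedy sequences and binary digits\<close>

text \<open>Finite initial segments are needed because the second half of a greedy segment of length \<open>2^(n + 1)\<close>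
  is greedy only up to its end.\<close>

definition greedy_upto :: "real \<Rightarrow> (nat \<Rightarrow> complex) \<Rightarrow> nat \<Rightarrow> bool" where
  "greedy_upto s a L \<longleftrightarrow> (\<forall>n<L. a n \<in> sphere 0 1) \<and>
     (\<forall>n\<ge>1. n < L \<longrightarrow> (\<forall>x\<in>sphere 0 1. potential s a n (a n) \<le> potential s a n x))"

definition minimizer :: "real \<Rightarrow> (nat \<Rightarrow> complex) \<Rightarrow> nat \<Rightarrow> complex \<Rightarrow> bool" where
  "minimizer s a n x \<longleftrightarrow> x \<in> sphere 0 1 \<and> (\<forall>y\<in>sphere 0 1. potential s a n x \<le> potential s a n y)"

lemma greedy_upto_mono: "greedy_upto s a L \<Longrightarrow> L' \<le> L \<Longrightarrow> greedy_upto s a L'"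
  by (auto simp: greedy_upto_def)

lemma greedy_upto_minimizer: "greedy_upto s a L \<Longrightarrow> 1 \<le> n \<Longrightarrow> n < L \<Longrightarrow> minimizer s a n (a n)"
  by (auto simp: greedy_upto_def minimizer_def)

lemma potential_split: "potential s a (m + k) x = potential s a m x + potential s (\<lambda>i. a (m + i)) k x"
  unfolding potential_def by (induction k) (simp_all add: add.assoc)

lemma potential_at_earlier_point:
  assumes "i < n" "a i = x"
  shows "potential s a n x = \<infinity>"
proof -
  have "potential s a n x = riesz_kernel s x (a i) + (\<Sum>k\<in>{..<n} - {i}. riesz_kernel s x (a k))"
    unfolding potential_def using assms by (intro sum.remove) auto
  moreover have "(\<Sum>k\<in>{..<n} - {i}. riesz_kernel s x (a k)) \<ge> 0"
    by (intro sum_nonneg) (auto simp: riesz_kernel_def)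
  ultimately show ?thesis
    using assms(2) by (auto simp: riesz_kernel_def)
qed

lemma ereal_add_le_both_minimal:
  fixes V P e p :: ereal
  assumes "\<bar>V\<bar> \<noteq> \<infinity>" "\<bar>P\<bar> \<noteq> \<infinity>" "V \<le> e" "P \<le> p" "e + p \<le> V + P"
  shows "e \<le> V" "p \<le> P"
  using assms by (cases V; cases P; cases e; cases p; simp)+

lemma set_decode_add_power_2:
  assumes "k < 2 ^ n"
  shows "set_decode (2 ^ n + k) = insert n (set_decode k)" and "n \<notin> set_decode k"
proof -
  show n: "n \<notin> set_decode k"
    using assms by (simp add: set_decode_def)
  show "set_decode (2 ^ n + k) = insert n (set_decode k)"
    by (rule set_decode_plus_power_2[OF n])
qed

text \<open>Doubling: a segment longer than \<open>2^n\<close> consists of a full coset and a greedy segment in the coset of its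
  midpoints. The existence of a minimizer is part of the induction because it provides a common minimizer
  of the potentials of the two blocks.\<close>

lemma greedy_minimizer_structure:
  assumes s: "s > 0"
  shows "greedy_upto s a L \<Longrightarrow> 1 \<le> L \<Longrightarrow> L < 2 ^ n \<Longrightarrow>
    (\<exists>x. minimizer s a L x) \<and>
    (\<forall>x. minimizer s a L x \<longrightarrow> x ^ (2 ^ n) = a 0 ^ (2 ^ n) \<and>
        potential s a L x = ereal (\<Sum>i\<in>set_decode L. midpoint_energy s (2 ^ i)))"
proof (induction n arbitrary: a L)
  case 0
  then show ?case by simp
next
  case (Suc n)
  note IH = Suc.IH and greedy_L = Suc.prems(1)
  define m :: nat where "m = 2 ^ n"
  define w where "w = a 0 ^ m"
  have m: "m > 0" by (simp add: m_def)
  have pow_Suc: "x ^ (2 ^ Suc n) = (x ^ m)\<^sup>2" for x :: complex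
    by (simp add: m_def mult.commute flip: power_mult)
  show ?case
  proof (cases "L < m")
    case True
    then show ?thesis
      using IH[of a L] Suc.prems unfolding pow_Suc by (auto simp: m_def)
  next
    case False
    define b where "b i = a (m + i)" for i
    define V where "V = midpoint_energy s m"
    have gm: "greedy_upto s a m"
      using Suc.prems(1) False by (auto intro: greedy_upto_mono)
    have sph: "norm (a i) = 1" if "i < L" for i
      using Suc.prems(1) that by (simp add: greedy_upto_def)
    have w: "norm w = 1"
      using sph[of 0] Suc.prems(2) by (simp add: w_def norm_power)
    \<comment> \<open>Finiteness of the minimal potential excludes repetitions, so that the first \<open>m\<close> points exhaust the coset.\<close>
    have early: "a i ^ m = w \<and> a i \<notin> a ` {..<i}" if i: "i < m" for i
    proof (cases "i = 0")
      case False
      have "minimizer s a i (a i)"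
        using gm i False by (intro greedy_upto_minimizer) auto
      moreover have "greedy_upto s a i"
        using gm i by (auto intro: greedy_upto_mono)
      ultimately have "a i ^ m = w" "potential s a i (a i) \<noteq> \<infinity>"
        using IH[of a i] i False by (auto simp: m_def w_def)
      then show ?thesis
        using potential_at_earlier_point by fastforce
    qed (simp add: w_def)
    have inj: "inj_on a {..<m}"
    proof (rule linorder_inj_onI)
      fix i j :: nat assume "i < j" "j \<in> {..<m}"
      then have "a i \<in> a ` {..<j}" "a j \<notin> a ` {..<j}"
        using early[of j] by auto
      then show "a i \<noteq> a j" by metis
    qed auto
    have "a ` {..<m} = {z. z ^ m = w}"
    proof (rule card_subset_eq)
      have "w \<noteq> 0" using w by auto
      then show "card (a ` {..<m}) = card {z. z ^ m = w}"
        using card_nth_roots[of w m] m by (simp add: card_image[OF inj])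
    qed (use early finite_roots[OF m] in auto)
    then have pot_m: "potential s a m x = coset_potential s m w x" for x
      using sum.reindex[OF inj, of "riesz_kernel s x"] by (simp add: potential_def coset_potential_def)
    have pot: "potential s a (m + k) x = coset_potential s m w x + potential s b k x" for k x
      unfolding potential_split pot_m b_def ..
    obtain y0 where y0: "norm y0 = 1" "y0 ^ m = - w"
    proof -
      obtain y where y: "y ^ m = - w"
        using card_nth_roots[of "- w" m] m w
        by (metis (mono_tags, lifting) card.empty empty_Collect_eq less_numeral_extra(3) neg_equal_0_iff_equal norm_zero zero_neq_one)
      then have "norm y ^ m = 1"
        using w by (metis norm_minus_cancel norm_power)
      then have "norm y = 1"
        using power_eq_imp_eq_base[of "norm y" m 1] m by simp
      with y that show ?thesis by blast
    qed
    have cos_V: "coset_potential s m w x = ereal V" if "norm x = 1" "x ^ m = - w" for x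
      unfolding V_def using coset_potential_midpoint[OF s m that(1) w that(2)] .
    have cos_ge: "ereal V \<le> coset_potential s m w x" if "norm x = 1" for x
      unfolding V_def using coset_potential_ge(1)[OF s m that w] .
    have cos_le: "x ^ m = - w" if "norm x = 1" "coset_potential s m w x \<le> ereal V" for x
      using coset_potential_ge(2)[OF s m that(1) w] that(2) unfolding V_def .
    have min_m: "x ^ m = - w" if "minimizer s a m x" for x
    proof -
      have "norm x = 1" "coset_potential s m w x \<le> coset_potential s m w y0"
        using that y0(1) by (simp_all add: minimizer_def pot_m)
      then show ?thesis
        using cos_le cos_V[OF y0] by simp
    qed
    have b0: "b 0 ^ m = - w" if "m < L"
      using min_m[OF greedy_upto_minimizer[OF Suc.prems(1) _ that]] m by (simp add: b_def)
    \<comment> \<open>A minimizer of the sum of two potentials with a common minimizer minimizes each of them.\<close>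
    have split_min: "x ^ m = - w \<and> minimizer s b k x"
      if x: "minimizer s a (m + k) x" and z: "minimizer s b k z" "z ^ m = - w"
        and fin: "\<bar>potential s b k z\<bar> \<noteq> \<infinity>" for k x z
    proof -
      have nx: "norm x = 1" and nz: "norm z = 1"
        using x z by (auto simp: minimizer_def)
      have "potential s a (m + k) x \<le> potential s a (m + k) z"
        using x nz by (simp add: minimizer_def)
      then have "coset_potential s m w x + potential s b k x \<le> ereal V + potential s b k z"
        unfolding pot cos_V[OF nz z(2)] .
      moreover have "potential s b k z \<le> potential s b k x"
        using z(1) nx by (simp add: minimizer_def)
      ultimately have "coset_potential s m w x \<le> ereal V" "potential s b k x \<le> potential s b k z"
        using ereal_add_le_both_minimal[OF _ fin cos_ge[OF nx]] by auto
      then show ?thesis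
        using cos_le[OF nx] z(1) nx by (auto simp: minimizer_def intro: order_trans)
    qed
    have k_less: "L - m < m"
      using Suc.prems(3) by (simp add: m_def)
    have greedy_b: "greedy_upto s b k" if "k \<le> L - m" for k
      using that
    proof (induction k)
      case 0
      then show ?case by (simp add: greedy_upto_def)
    next
      case (Suc k)
      then have gk: "greedy_upto s b k" and k: "m + k < L" by simp_all
      have bk: "b k \<in> sphere 0 1"
        using sph[OF k] by (simp add: b_def)
      have "minimizer s b k (b k)" if k1: "1 \<le> k"
      proof -
        have "k < 2 ^ n"
          using k k_less unfolding m_def by linarith
        from IH[OF gk k1 this]
        obtain z where z: "minimizer s b k z" "z ^ m = b 0 ^ m" "\<bar>potential s b k z\<bar> \<noteq> \<infinity>"
          by (auto simp: m_def)
        have "minimizer s a (m + k) (b k)"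
          unfolding b_def using greedy_upto_minimizer[OF greedy_L, of "m + k"] m k by simp
        then show ?thesis
          using split_min z b0 k by auto
      qed
      with gk bk show ?case
        by (auto simp: greedy_upto_def minimizer_def less_Suc_eq)
    qed
    define k where "k = L - m"
    have L: "L = m + k" using False by (simp add: k_def)
    show ?thesis
    proof (cases "k = 0")
      case True
      have "set_decode L = {n}"
        using set_decode_add_power_2[of 0 n] True by (simp add: L m_def)
      then have dec: "(\<Sum>i\<in>set_decode L. midpoint_energy s (2 ^ i)) = V"
        by (simp add: V_def m_def)
      have "minimizer s a m y0"
        using y0 cos_ge cos_V by (auto simp: minimizer_def pot_m)
      moreover have "x ^ (2 ^ Suc n) = a 0 ^ (2 ^ Suc n) \<and> potential s a m x = ereal V"
        if x: "minimizer s a m x" for x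
      proof
        have "x ^ m = - w" by (rule min_m[OF x])
        then show "x ^ (2 ^ Suc n) = a 0 ^ (2 ^ Suc n)"
          unfolding pow_Suc by (simp add: w_def)
        show "potential s a m x = ereal V"
          unfolding pot_m using x min_m[OF x] by (intro cos_V) (auto simp: minimizer_def)
      qed
      ultimately show ?thesis
        using True unfolding dec unfolding L by auto
    next
      case nz: False
      then have "m < L" by (simp add: L)
      note b0 = b0[OF this]
      have k: "1 \<le> k" "k < 2 ^ n" using nz k_less by (simp_all add: k_def m_def)
      have gk: "greedy_upto s b k" by (rule greedy_b) (simp add: k_def)
      note IHk = IH[OF gk k]
      obtain z where z: "minimizer s b k z" using IHk by blast
      have zw: "z ^ m = - w" and fin: "\<bar>potential s b k z\<bar> \<noteq> \<infinity>"
        using IHk z b0 by (auto simp: m_def)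
      have dec: "(\<Sum>i\<in>set_decode L. midpoint_energy s (2 ^ i)) =
          V + (\<Sum>i\<in>set_decode k. midpoint_energy s (2 ^ i))"
        using set_decode_add_power_2[OF k(2)] unfolding L m_def V_def by simp
      have "minimizer s a L z"
        unfolding L minimizer_def pot
        using z zw cos_V cos_ge by (auto simp: minimizer_def intro!: add_mono)
      moreover have "x ^ (2 ^ Suc n) = a 0 ^ (2 ^ Suc n) \<and>
          potential s a L x = ereal (V + (\<Sum>i\<in>set_decode k. midpoint_energy s (2 ^ i)))"
        if x: "minimizer s a L x" for x
      proof
        have x': "x ^ m = - w" "minimizer s b k x"
          using split_min[OF x[unfolded L] z zw fin] by auto
        then show "x ^ (2 ^ Suc n) = a 0 ^ (2 ^ Suc n)"
          unfolding pow_Suc by (simp add: w_def)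
        have "norm x = 1" using x by (simp add: minimizer_def)
        then show "potential s a L x = ereal (V + (\<Sum>i\<in>set_decode k. midpoint_energy s (2 ^ i)))"
          unfolding L pot using cos_V x' IHk by simp
      qed
      ultimately show ?thesis
        unfolding dec by blast
    qed
  qed
qed

lemma greedy_potential_eq:
  assumes "s > 0" "greedy_energy_sequence s a" "N \<ge> 1"
  shows "potential s a N (a N) = ereal (\<Sum>i\<in>set_decode N. midpoint_energy s (2 ^ i))"
proof -
  have "greedy_upto s a (Suc N)"
    using assms(2) by (simp add: greedy_energy_sequence_def greedy_upto_def)
  then have "greedy_upto s a N" "minimizer s a N (a N)"
    using assms(3) greedy_upto_mono greedy_upto_minimizer by (auto simp: le_SucI)
  with greedy_minimizer_structure[OF assms(1), of a N N] assms(3) show ?thesis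
    by (auto simp: less_exp)
qed

section \<open>The differential equation for powers of sinc\<close>

definition log_sinc_fps :: "complex fps" where
  "log_sinc_fps = fps_expansion log_sinc 0"

text \<open>The Taylor series of \<open>sinc_neg_power s\<close>. In this form its coefficients are visibly polynomials
  in \<open>s\<close>, and the product rule for powers of sinc becomes an identity of formal power series.\<close>

definition sinc_pow_fps :: "complex \<Rightarrow> complex fps" where
  "sinc_pow_fps s = fps_exp (- s) oo log_sinc_fps"

lemma log_sinc_has_fps_expansion: "log_sinc has_fps_expansion log_sinc_fps"
  unfolding log_sinc_fps_def
  by (rule has_fps_expansion_fps_expansion[OF open_ball _ log_sinc_holomorphic]) simp

lemma log_sinc_fps_nth_0 [simp]: "log_sinc_fps $ 0 = 0"
  using has_fps_expansion_imp_0_eq_fps_nth_0[OF log_sinc_has_fps_expansion] log_sinc_0 by simp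

lemma sinc_neg_power_has_fps_expansion:
  "sinc_neg_power s has_fps_expansion sinc_pow_fps s"
proof -
  have "((\<lambda>z. exp (- s * z)) \<circ> log_sinc) has_fps_expansion (fps_exp (- s) oo log_sinc_fps)"
    by (intro has_fps_expansion_compose has_fps_expansion_exp log_sinc_has_fps_expansion) simp
  then show ?thesis
    by (simp add: sinc_neg_power_def[abs_def] sinc_pow_fps_def o_def)
qed

lemma sinc_pow_fps_eq_alpha:
  "sinc_pow_fps s = Abs_fps (\<lambda>n. if even n then alpha (n div 2) s else 0)" (is "_ = Abs_fps ?c")
proof (rule fps_expansion_unique_complex[OF sinc_neg_power_has_fps_expansion])
  show "sinc_neg_power s has_fps_expansion Abs_fps ?c"
  proof (rule has_fps_expansionI)
    have "eventually (\<lambda>z. z \<in> ball 0 1) (nhds (0::complex))"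
      by (intro eventually_nhds_in_open) auto
    then show "eventually (\<lambda>z. (\<lambda>n. fps_nth (Abs_fps ?c) n * z ^ n) sums sinc_neg_power s z) (nhds 0)"
    proof eventually_elim
      case (elim z)
      have "(\<lambda>n. ?c n * z ^ n) sums sinc_neg_power s z
              \<longleftrightarrow> (\<lambda>n. ?c (2 * n) * z ^ (2 * n)) sums sinc_neg_power s z"
        by (rule sums_mono_reindex[symmetric]) (auto simp: strict_mono_def elim!: evenE)
      with alpha_sums[OF elim, of s] show ?case by simp
    qed
  qed
qed

lemma alpha_eq_nth: "alpha n s = sinc_pow_fps s $ (2 * n)"
  by (simp add: sinc_pow_fps_eq_alpha)

lemma alpha_polynomial:
  "alpha n s = (\<Sum>i=0..2*n. (- s) ^ i / fact i * (log_sinc_fps ^ i) $ (2 * n))"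
  by (simp add: alpha_eq_nth sinc_pow_fps_def fps_compose_nth)

lemma alpha_differentiable: "alpha n field_differentiable (at s)"
  unfolding alpha_polynomial[abs_def]
  by (intro derivative_intros) auto

lemma alpha_0 [simp]: "alpha 0 s = 1"
  by (simp add: alpha_polynomial)

lemma sinc_pow_fps_0 [simp]: "sinc_pow_fps 0 = 1"
  by (simp add: sinc_pow_fps_def)

lemma sinc_pow_fps_mult: "sinc_pow_fps s * sinc_pow_fps t = sinc_pow_fps (s + t)"
  by (simp add: sinc_pow_fps_def fps_compose_mult_distrib[symmetric] fps_exp_add_mult[symmetric]
      add.commute)

lemma fps_deriv_sinc_pow_fps:
  "fps_deriv (sinc_pow_fps s) = fps_const (- s) * sinc_pow_fps s * fps_deriv log_sinc_fps"
  by (simp add: sinc_pow_fps_def fps_compose_deriv fps_compose_mult_distrib del: fps_const_neg)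

lemma fps_X_sinc_eq_fps_sin:
  "fps_const (of_real pi) * (fps_X * sinc_pow_fps (- 1)) = fps_sin (of_real pi)"
proof (rule fps_expansion_unique_complex)
  show "(\<lambda>z. of_real pi * (z * sinc_neg_power (- 1) z)) has_fps_expansion
          fps_const (of_real pi) * (fps_X * sinc_pow_fps (- 1))"
    by (intro fps_expansion_intros sinc_neg_power_has_fps_expansion)
  have ev: "eventually (\<lambda>z. z \<in> ball 0 1) (nhds (0::complex))"
    by (intro eventually_nhds_in_open) auto
  have "(\<lambda>z. sin (of_real pi * z)) has_fps_expansion fps_sin (of_real pi :: complex)"
    by (rule has_fps_expansion_sin)
  also have "?this \<longleftrightarrow> (\<lambda>z. of_real pi * (z * sinc_neg_power (- 1) z)) has_fps_expansion
          fps_sin (of_real pi)"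
    by (rule has_fps_expansion_cong, rule eventually_mono[OF ev])
       (auto simp: sinc_neg_power_def exp_log_sinc sinc_pi_def)
  finally show "(\<lambda>z. of_real pi * (z * sinc_neg_power (- 1) z)) has_fps_expansion
          fps_sin (of_real pi)" .
qed

lemma fps_theta_nth: "(fps_X * fps_deriv F) $ k = of_nat k * (F $ k :: complex)"
  by (cases k) (auto)

text \<open>With \<open>\<theta> = z d/dz\<close>, \<open>E\<close> the series of \<open>sinc\<^sup>-\<^sup>s\<close> and \<open>F = (\<theta> - s) E\<close>, the left-hand side is
  \<open>(\<theta> - s - 1) F = z^(s + 2) d\<^sup>2/dz\<^sup>2 (z\<^sup>-\<^sup>s E)\<close>. So this is the differential equation
  \<open>g'' = s (s + 1) (\<pi> / sin (\<pi> z))^(s + 2) - \<pi>\<^sup>2 s\<^sup>2 g\<close> of \<open>g = (\<pi> / sin (\<pi> z))\<^sup>s\<close>, freed from the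
  non-integral power of \<open>z\<close>. All quantities are expressed by \<open>u = \<theta> (log sinc)\<close>: the equation \<open>sin\<^sup>2 + cos\<^sup>2 = 1\<close>
  gives \<open>(1 + u)\<^sup>2\<close>, and \<open>cos' = - sin\<close> gives \<open>\<theta> u\<close>.\<close>

lemma sinc_pow_fps_ODE:
  fixes s :: complex
  defines "E \<equiv> sinc_pow_fps s"
  defines "F \<equiv> fps_X * fps_deriv E - fps_const s * E"
  shows "fps_X * fps_deriv F - fps_const (s + 1) * F =
           fps_const (s * (s + 1)) * sinc_pow_fps (s + 2)
           - fps_const ((of_real pi)\<^sup>2 * s\<^sup>2) * (fps_X ^ 2 * E)"
proof -
  define u where "u = fps_X * fps_deriv log_sinc_fps"
  define S where "S = sinc_pow_fps (- 1)"
  define p :: "complex fps" where "p = fps_const (of_real pi)"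
  define c where "c = fps_const s"
  have dE: "fps_X * fps_deriv E = - c * E * u"
    by (simp add: E_def fps_deriv_sinc_pow_fps u_def c_def algebra_simps
        fps_const_neg[symmetric] del: fps_const_neg)
  have dS: "fps_X * fps_deriv S = S * u"
    by (simp add: S_def fps_deriv_sinc_pow_fps u_def algebra_simps)
  have sin: "fps_sin (of_real pi) = p * (fps_X * S)"
    using fps_X_sinc_eq_fps_sin by (simp add: p_def S_def)
  have "p * fps_cos (of_real pi) = fps_deriv (fps_sin (of_real pi))"
    by (simp add: fps_sin_deriv p_def)
  also have "\<dots> = p * (S * (1 + u))"
    unfolding sin by (simp add: p_def algebra_simps flip: dS)
  finally have cos: "fps_cos (of_real pi) = S * (1 + u)"
    by (simp add: p_def)
  have sq: "(S * (1 + u))\<^sup>2 + (p * (fps_X * S))\<^sup>2 = 1"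
    using fps_sin_cos_sum_of_squares[of "of_real pi :: complex"] unfolding sin cos .
  have du: "S * (u * (1 + u) + fps_X * fps_deriv u) = - (p\<^sup>2 * fps_X\<^sup>2 * S)"
  proof -
    have "S * (u * (1 + u) + fps_X * fps_deriv u) = (fps_X * fps_deriv S) * (1 + u) + fps_X * (S * fps_deriv u)"
      unfolding dS by (simp add: algebra_simps)
    also have "\<dots> = fps_X * fps_deriv (S * (1 + u))"
      by (simp add: algebra_simps)
    also have "\<dots> = - (fps_X * (p * fps_sin (of_real pi)))"
      unfolding cos[symmetric] by (simp add: fps_cos_deriv p_def fps_const_neg[symmetric] del: fps_const_neg)
    finally show ?thesis unfolding sin by (simp add: power2_eq_square algebra_simps)
  qed
  have inv: "sinc_pow_fps 2 * S\<^sup>2 = 1" "sinc_pow_fps 1 * S = 1"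
    by (simp_all add: S_def power2_eq_square sinc_pow_fps_mult)
  have du': "fps_X * fps_deriv u = - (p\<^sup>2 * fps_X\<^sup>2) - u * (1 + u)"
  proof -
    have "(sinc_pow_fps 1 * S) * (u * (1 + u) + fps_X * fps_deriv u) = - (p\<^sup>2 * fps_X\<^sup>2 * (sinc_pow_fps 1 * S))"
      using arg_cong[OF du, of "\<lambda>f. sinc_pow_fps 1 * f"] by (simp add: algebra_simps)
    then show ?thesis unfolding inv by (simp add: algebra_simps)
  qed
  have sq': "(1 + u)\<^sup>2 = sinc_pow_fps 2 - p\<^sup>2 * fps_X\<^sup>2"
  proof -
    have "(sinc_pow_fps 2 * S\<^sup>2) * (1 + u)\<^sup>2 + p\<^sup>2 * fps_X\<^sup>2 * (sinc_pow_fps 2 * S\<^sup>2) = sinc_pow_fps 2"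
      using arg_cong[OF sq, of "\<lambda>f. sinc_pow_fps 2 * f"] by (simp add: algebra_simps power2_eq_square)
    then show ?thesis unfolding inv by (simp add: algebra_simps)
  qed
  have F: "F = - (c * E * (1 + u))"
    by (simp add: F_def dE algebra_simps flip: c_def)
  have E2: "sinc_pow_fps (s + 2) = E * sinc_pow_fps 2"
    by (simp add: E_def sinc_pow_fps_mult)
  have c': "fps_deriv c = 0" "fps_const (s + 1) = c + 1" "fps_const (s * (s + 1)) = c * (c + 1)"
      "fps_const ((of_real pi)\<^sup>2 * s\<^sup>2) = p\<^sup>2 * c\<^sup>2"
    by (simp_all add: c_def p_def flip: fps_const_1_eq_1)
  have "fps_X * fps_deriv F = - (c * ((fps_X * fps_deriv E) * (1 + u) + E * (fps_X * fps_deriv u)))"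
    by (simp add: F c' algebra_simps)
  also have "\<dots> = - (c * E * (- c * u * (1 + u) + (- (p\<^sup>2 * fps_X\<^sup>2) - u * (1 + u))))"
    unfolding dE du' by (simp add: algebra_simps)
  finally have 1: "fps_X * fps_deriv F - fps_const (s + 1) * F =
      c * E * ((c + 1) * (1 + u)\<^sup>2 + p\<^sup>2 * fps_X\<^sup>2)"
    unfolding F c' by (simp add: algebra_simps power2_eq_square)
  show ?thesis
    unfolding 1 unfolding sq' E2 c' by (simp add: algebra_simps power2_eq_square)
qed

text \<open>Comparison of the coefficients of \<open>z^(2 n + 2)\<close> in the differential equation. At \<open>s = 2 n + 1\<close> the
  left-hand side has a simple zero; the value and the derivative there give the recursion of the coefficients
  at odd exponents and that of their derivatives.\<close>

lemma alpha_recurrence: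
  "(2 * of_nat (Suc n) - s) * (2 * of_nat (Suc n) - s - 1) * alpha (Suc n) s =
     s * (s + 1) * alpha (Suc n) (s + 2) - (of_real pi)\<^sup>2 * s\<^sup>2 * alpha n s"
proof -
  define E where "E = sinc_pow_fps s"
  define F where "F = fps_X * fps_deriv E - fps_const s * E"
  have F: "F $ k = (of_nat k - s) * E $ k" for k
    unfolding F_def by (simp only: fps_sub_nth fps_theta_nth fps_mult_left_const_nth) (simp add: algebra_simps)
  have "(fps_X * fps_deriv F - fps_const (s + 1) * F) $ k = (of_nat k - s - 1) * F $ k" for k
    by (simp only: fps_sub_nth fps_theta_nth fps_mult_left_const_nth) (simp add: algebra_simps)
  then have "(of_nat (2 * Suc n) - s - 1) * F $ (2 * Suc n) =
     s * (s + 1) * sinc_pow_fps (s + 2) $ (2 * Suc n) - (of_real pi)\<^sup>2 * s\<^sup>2 * (fps_X ^ 2 * E) $ (2 * Suc n)"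
    using sinc_pow_fps_ODE[of s, folded E_def, folded F_def]
    by (metis fps_sub_nth fps_mult_left_const_nth)
  moreover have "(fps_X ^ 2 * E) $ (2 * Suc n) = E $ (2 * n)"
    by (simp add: fps_X_power_mult_nth)
  ultimately show ?thesis
    unfolding alpha_eq_nth F by (simp add: E_def algebra_simps)
qed

section \<open>Values on the real axis\<close>

text \<open>Reality of the logarithm of sinc, and hence of its powers, on the real axis follows from the
  reflection \<open>f \<mapsto> cnj \<circ> f \<circ> cnj\<close> and uniqueness of the branch.\<close>

lemma cnj_sinc_pi: "cnj (sinc_pi (cnj z)) = sinc_pi z"
  by (simp add: sinc_pi_def cnj_sin)

lemma cnj_log_sinc:
  assumes "z \<in> ball 0 1"
  shows "cnj (log_sinc (cnj z)) = log_sinc z"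
proof (rule log_sinc_unique[where f = "\<lambda>z. cnj (log_sinc (cnj z))", OF _ _ _ assms])
  have "cnj ` ball 0 1 = ball 0 1"
    by (force simp: image_iff intro: bexI[of _ "cnj _"])
  then have "cnj \<circ> log_sinc \<circ> cnj holomorphic_on ball 0 1"
    using holomorphic_on_compose_cnj_cnj[of log_sinc "ball 0 1"] log_sinc_holomorphic by simp
  then show "(\<lambda>z. cnj (log_sinc (cnj z))) holomorphic_on ball 0 1"
    by (simp add: o_def)
  show "exp (cnj (log_sinc (cnj z))) = sinc_pi z" if "z \<in> ball 0 1" for z
    using that by (simp add: exp_log_sinc cnj_sinc_pi flip: exp_cnj)
qed (simp add: log_sinc_0)

lemma log_sinc_of_real:
  assumes "0 < y" "y < 1"
  shows "log_sinc (of_real y) = of_real (ln (sin (pi * y) / (pi * y)))"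
proof -
  have y: "of_real y \<in> ball (0::complex) 1" using assms by simp
  have "cnj (log_sinc (of_real y)) = log_sinc (of_real y)"
    using cnj_log_sinc[OF y] by simp
  then obtain r where r: "log_sinc (of_real y) = of_real r"
    using Reals_cnj_iff by (metis Reals_cases)
  have "complex_of_real (exp r) = of_real (sin (pi * y) / (pi * y))"
    using exp_log_sinc[OF y] assms by (simp add: r sinc_pi_def flip: exp_of_real sin_of_real)
  then have "exp r = sin (pi * y) / (pi * y)"
    by (simp only: of_real_eq_iff)
  then show ?thesis
    unfolding r by (metis ln_exp)
qed

lemma alpha_real: "alpha n (of_real s) = of_real (Re (alpha n (of_real s)))"
proof -
  have "(\<lambda>k. cnj (alpha k (of_real s))) = (\<lambda>k. alpha k (of_real s))"
  proof (rule even_power_series_unique[where f = "sinc_neg_power (of_real s)"])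
    fix z :: complex assume z: "z \<in> ball 0 1"
    then have "cnj z \<in> ball 0 1" by simp
    from alpha_sums[OF this, of "of_real s"]
    have "(\<lambda>k. cnj (alpha k (of_real s) * cnj z ^ (2 * k))) sums cnj (sinc_neg_power (of_real s) (cnj z))"
      by (simp only: sums_cnj)
    moreover have "cnj (sinc_neg_power (of_real s) (cnj z)) = sinc_neg_power (of_real s) z"
      using cnj_log_sinc[OF z] by (simp add: sinc_neg_power_def exp_cnj)
    ultimately show "(\<lambda>k. cnj (alpha k (of_real s)) * z ^ (2 * k)) sums sinc_neg_power (of_real s) z"
      by simp
  qed (rule alpha_sums)
  then show ?thesis
    by (metis Reals_cnj_iff of_real_Re)
qed

lemma log_sinc_has_field_derivative:
  assumes z: "z \<in> ball 0 1" "z \<noteq> 0"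
  shows "(log_sinc has_field_derivative
           of_real pi * cos (of_real pi * z) / sin (of_real pi * z) - 1 / z) (at z)"
proof -
  have sin: "sin (of_real pi * z) \<noteq> 0"
    using sinc_pi_nonzero[OF z(1)] z(2) by (simp add: sinc_pi_def)
  define d where "d = deriv log_sinc z"
  have d: "(log_sinc has_field_derivative d) (at z)"
    unfolding d_def by (rule holomorphic_derivI[OF log_sinc_holomorphic open_ball z(1)])
  have exp_z: "exp (log_sinc z) = sin (of_real pi * z) / (of_real pi * z)"
    using z by (simp add: exp_log_sinc sinc_pi_def)
  have "((\<lambda>z. exp (log_sinc z)) has_field_derivative exp (log_sinc z) * d) (at z)"
    by (rule DERIV_fun_exp[OF d])
  then have "((\<lambda>z. sin (of_real pi * z) / (of_real pi * z)) has_field_derivative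
      sin (of_real pi * z) / (of_real pi * z) * d) (at z)"
    unfolding exp_z
    by (rule has_field_derivative_transform_within_open[of _ _ _ "ball 0 1 - {0}"])
       (use z in \<open>auto simp: exp_log_sinc sinc_pi_def open_delete\<close>)
  moreover have "((\<lambda>z. sin (of_real pi * z) / (of_real pi * z)) has_field_derivative
      (of_real pi * cos (of_real pi * z) * (of_real pi * z) - sin (of_real pi * z) * of_real pi)
        / (of_real pi * z)\<^sup>2) (at z)"
    using z by (auto intro!: derivative_eq_intros simp: power2_eq_square)
  ultimately have "sin (of_real pi * z) / (of_real pi * z) * d =
      (of_real pi * cos (of_real pi * z) * (of_real pi * z) - sin (of_real pi * z) * of_real pi)
        / (of_real pi * z)\<^sup>2"
    by (rule DERIV_unique)
  then have "of_real pi * (sin (of_real pi * z) + d * z * sin (of_real pi * z)) =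
      of_real pi * (z * of_real pi * cos (of_real pi * z))"
    using z(2) by (simp add: field_simps power2_eq_square)
  then have "sin (of_real pi * z) + d * z * sin (of_real pi * z) = z * of_real pi * cos (of_real pi * z)"
    by (simp only: mult_cancel_left) simp
  then have "d = of_real pi * cos (of_real pi * z) / sin (of_real pi * z) - 1 / z"
    using sin z(2) by (simp add: field_simps power2_eq_square)
  with d show ?thesis by simp
qed

lemma alpha_powser_sums:
  assumes "norm w < 1"
  shows "(\<lambda>n. alpha n s * w ^ n) sums sinc_neg_power s (csqrt w)"
proof -
  have "norm (csqrt w) ^ 2 < 1"
    using assms by (metis norm_power power2_csqrt)
  then have "csqrt w \<in> ball 0 1"
    by (simp add: power_less_one_iff)
  from alpha_sums[OF this] show ?thesis
    by (simp add: power_mult)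
qed

text \<open>At \<open>y = 1/2\<close> the function \<open>(\<pi> / sin (\<pi> y))\<^sup>s = (\<Sum>n. \<alpha>\<^sub>n(s) y^(2 n - s))\<close> has derivative \<open>0\<close>, since
  \<open>cos (\<pi>/2) = 0\<close>. Up to the factor \<open>2^(s + 1)\<close> this sum is that derivative.\<close>

lemma alpha_quarter_derivative_sums:
  "(\<lambda>n. (2 * of_nat n - s) * alpha n s * (1/4) ^ n) sums 0"
proof -
  define F' where "F' = (\<Sum>n. diffs (\<lambda>n. alpha n s) n * (1/4) ^ n)"
  have sm: "summable (\<lambda>n. alpha n s * w ^ n)" if "norm w < 1" for w
    using alpha_powser_sums[OF that] by (rule sums_summable)
  \<comment> \<open>In the variable \<open>w = z\<^sup>2\<close> the even power series becomes an ordinary one.\<close>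
  have F: "((\<lambda>w. \<Sum>n. alpha n s * w ^ n) has_field_derivative F') (at (1/4))"
    unfolding F'_def by (rule termdiffs_strong'[where K = 1]) (auto intro: sm)
  have "((\<lambda>z::complex. z\<^sup>2) has_field_derivative 1) (at (1/2))"
    by (auto intro!: derivative_eq_intros)
  then have "((\<lambda>z. \<Sum>n. alpha n s * (z\<^sup>2) ^ n) has_field_derivative F' * 1) (at (1/2))"
    using F by (intro DERIV_chain2[where f = "\<lambda>w. \<Sum>n. alpha n s * w ^ n"]) (auto simp: power2_eq_square)
  moreover have ev: "eventually (\<lambda>z. z \<in> ball 0 1) (nhds (1/2::complex))"
    by (intro eventually_nhds_in_open) auto
  have "eventually (\<lambda>z. (\<Sum>n. alpha n s * (z\<^sup>2) ^ n) = sinc_neg_power s z) (nhds (1/2))"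
    using ev by eventually_elim (use alpha_sums in \<open>auto simp: power_mult sums_iff\<close>)
  ultimately have 1: "(sinc_neg_power s has_field_derivative F') (at (1/2))"
    by (subst (asm) DERIV_cong_ev[OF refl _ refl]) auto
  have L: "(log_sinc has_field_derivative - 2) (at (1/2))"
  proof -
    have "of_real pi * (1/2) = complex_of_real (pi / 2)" by simp
    then have "cos (of_real pi * (1/2) :: complex) = 0"
      by (simp only: cos_of_real) simp
    then show ?thesis
      using log_sinc_has_field_derivative[of "1/2"] by simp
  qed
  have 2: "(sinc_neg_power s has_field_derivative 2 * s * sinc_neg_power s (1/2)) (at (1/2))"
    unfolding sinc_neg_power_def[abs_def]
    by (auto intro!: derivative_eq_intros L)
  from DERIV_unique[OF 1 2] have F'_eq: "F' = 2 * s * sinc_neg_power s (1/2)" .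
  have "summable (\<lambda>n. diffs (\<lambda>n. alpha n s) n * (1/4) ^ n)"
    by (rule termdiff_converges[where K = 1]) (auto intro: sm)
  then have "(\<lambda>n. diffs (\<lambda>n. alpha n s) n * (1/4) ^ n * (1/2)) sums (F' * (1/2))"
    unfolding F'_def by (intro sums_mult2 summable_sums)
  moreover have "diffs (\<lambda>n. alpha n s) n * (1/4) ^ n * (1/2)
      = 2 * of_nat (Suc n) * alpha (Suc n) s * (1/4) ^ Suc n" for n
    by (simp add: diffs_def)
  moreover have "F' * (1/2) = s * sinc_neg_power s (1/2)"
    by (simp add: F'_eq)
  ultimately have "(\<lambda>n. 2 * of_nat (Suc n) * alpha (Suc n) s * (1/4) ^ Suc n) sums (s * sinc_neg_power s (1/2))"
    by (simp only:)
  then have 3: "(\<lambda>n. 2 * of_nat n * alpha n s * (1/4) ^ n) sums (s * sinc_neg_power s (1/2))"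
    by (subst (asm) sums_Suc_iff) simp
  have "(\<lambda>n. s * (alpha n s * (1/4) ^ n)) sums (s * sinc_neg_power s (1/2))"
    using alpha_sums[of "1/2" s] by (intro sums_mult) (simp add: power_mult power2_eq_square)
  from sums_diff[OF 3 this] show ?thesis
    by (simp add: algebra_simps)
qed


section \<open>The coefficients at odd exponents\<close>

lemma alpha_odd_Suc:
  "alpha (Suc M) (of_nat (2 * Suc M + 1)) =
     (of_real pi)\<^sup>2 * of_nat (2 * M + 1) / of_nat (2 * M + 2) * alpha M (of_nat (2 * M + 1))"
proof -
  define s :: complex where "s = of_nat (2 * M + 1)"
  have s12: "of_nat (2 * M + 2) = s + 1" "of_nat (2 * Suc M + 1) = s + 2"
    by (simp_all add: s_def)
  have s: "s \<noteq> 0" "s + 1 \<noteq> 0"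
    unfolding s_def s12(1)[symmetric, unfolded s_def] of_nat_eq_0_iff by simp_all
  have "2 * of_nat (Suc M) - s - 1 = 0" by (simp add: s_def)
  then have "s * ((s + 1) * alpha (Suc M) (s + 2)) = s * ((of_real pi)\<^sup>2 * s * alpha M s)"
    using alpha_recurrence[of M s] by (simp add: power2_eq_square algebra_simps)
  then have "(s + 1) * alpha (Suc M) (s + 2) = (of_real pi)\<^sup>2 * s * alpha M s"
    using s by (simp only: mult_cancel_left) simp
  then show ?thesis
    unfolding s12 s_def[symmetric] using s(2) by (simp add: field_simps)
qed

lemma alpha_odd:
  "alpha M (of_nat (2 * M + 1)) = of_real (pi ^ (2 * M) * pochhammer (1/2) M / fact M)"
proof (induction M)
  case (Suc M)
  have "pi\<^sup>2 * real (2 * M + 1) / real (2 * M + 2) * (pi ^ (2 * M) * pochhammer (1/2) M / fact M) =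
          pi ^ (2 * Suc M) * pochhammer (1/2) (Suc M) / fact (Suc M)"
    by (simp add: pochhammer_Suc power2_eq_square divide_simps)
  moreover have "alpha (Suc M) (of_nat (2 * Suc M + 1)) =
      of_real (pi\<^sup>2 * real (2 * M + 1) / real (2 * M + 2) * (pi ^ (2 * M) * pochhammer (1/2) M / fact M))"
    unfolding alpha_odd_Suc Suc by simp
  ultimately show ?case by (simp only:)
qed simp

text \<open>The derivative of the recurrence in \<open>s\<close>, at the zero \<open>s = 2 M + 1\<close> of its left-hand side.\<close>

lemma alpha_derivative_recurrence:
  fixes M :: nat
  defines "s \<equiv> of_nat (2 * M + 1) :: complex"
  shows "- alpha (Suc M) s =
      (2 * s + 1) * alpha (Suc M) (s + 2) + s * (s + 1) * deriv (alpha (Suc M)) (s + 2)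
      - (of_real pi)\<^sup>2 * (2 * s * alpha M s + s\<^sup>2 * deriv (alpha M) s)"
proof -
  have D: "(alpha n has_field_derivative deriv (alpha n) w) (at w)" for n w
    using alpha_differentiable by (simp add: field_differentiable_derivI)
  have D2: "((\<lambda>t. alpha n (t + 2)) has_field_derivative deriv (alpha n) (s + 2)) (at s)" for n
    using DERIV_shift[of "alpha n" "deriv (alpha n) (s + 2)" s 2] D by simp
  have s: "2 * of_nat (Suc M) - s - 1 = 0" by (simp add: s_def)
  have "((\<lambda>t. (2 * of_nat (Suc M) - t) * (2 * of_nat (Suc M) - t - 1) * alpha (Suc M) t)
          has_field_derivative - alpha (Suc M) s) (at s)"
    by (rule derivative_eq_intros refl D)+ (simp add: s_def algebra_simps)
  moreover have "((\<lambda>t. t * (t + 1) * alpha (Suc M) (t + 2) - (of_real pi)\<^sup>2 * t\<^sup>2 * alpha M t)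
          has_field_derivative (2 * s + 1) * alpha (Suc M) (s + 2) + s * (s + 1) * deriv (alpha (Suc M)) (s + 2)
      - (of_real pi)\<^sup>2 * (2 * s * alpha M s + s\<^sup>2 * deriv (alpha M) s)) (at s)"
    by (rule derivative_eq_intros refl D D2)+ (simp add: algebra_simps power2_eq_square)
  ultimately show ?thesis
    unfolding alpha_recurrence by (rule DERIV_unique)
qed

section \<open>The finite part of the integral\<close>

text \<open>The finite part at \<open>0\<close> of the integral of \<open>(\<pi> / sin (\<pi> y))^(2 M + 1) = (\<Sum>n. \<alpha>\<^sub>n y^(2 n - 2 M - 1))\<close> over \<open>[0, 1/2]\<close>:
  the value at \<open>1/2\<close> of the primitive without constant term. The term \<open>n = M\<close> of that primitive is
  \<open>\<alpha>\<^sub>M ln y\<close>; in the series it contributes \<open>0\<close> because its denominator is \<open>0\<close>.\<close>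

definition finite_part :: "nat \<Rightarrow> complex" where
  "finite_part M = - alpha M (of_nat (2 * M + 1)) * of_real (ln 2)
     + 4 ^ M * (\<Sum>n. alpha n (of_nat (2 * M + 1)) * (1/4) ^ n / (2 * (of_nat n - of_nat M)))"

lemma summable_norm_alpha_quarter: "summable (\<lambda>n. norm (alpha n s * (1/4) ^ n))"
  by (rule powser_insidea[where x = "1/2"]) (use alpha_powser_sums[of "1/2" s] in \<open>auto simp: sums_iff\<close>)

lemma summable_finite_part:
  "summable (\<lambda>n. alpha n s * (1/4) ^ n / (2 * (of_nat n - of_nat M)))"
proof (rule summable_comparison_test'[where N = 0, OF summable_norm_alpha_quarter])
  fix n
  have "norm (of_nat n - of_nat M :: complex) = \<bar>real_of_int (int n - int M)\<bar>"
    by (metis norm_of_int of_int_diff of_int_of_nat_eq)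
  moreover have "int n - int M = 0 \<or> \<bar>int n - int M\<bar> \<ge> 1" by linarith
  then have "real_of_int (int n - int M) = 0 \<or> \<bar>real_of_int (int n - int M)\<bar> \<ge> 1"
    by linarith
  ultimately have d: "norm (2 * (of_nat n - of_nat M) :: complex) = 0 \<or> norm (2 * (of_nat n - of_nat M) :: complex) \<ge> 1"
    unfolding norm_mult by auto
  have "x / d \<le> x" if "x \<ge> 0" "d = 0 \<or> d \<ge> 1" for x d :: real
    using that by (auto simp: divide_le_eq mult_le_cancel_left1)
  from this[OF norm_ge_zero d] show
    "norm (alpha n s * (1/4) ^ n / (2 * (of_nat n - of_nat M))) \<le> norm (alpha n s * (1/4) ^ n)"
    by (simp only: norm_divide)
qed

text \<open>Integration of the equation \<open>g\<^sub>s'' = s (s + 1) g\<^sub>s\<^sub>+\<^sub>2 - \<pi>\<^sup>2 s\<^sup>2 g\<^sub>s\<close> of \<open>g\<^sub>s = (\<pi> / sin (\<pi> y))\<^sup>s\<close> in the sense of finite parts.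
  The derivative of \<open>g\<^sub>s\<close> vanishes at \<open>1/2\<close>, but its expansion at \<open>0\<close> has the constant term \<open>\<alpha>\<^sub>M\<^sub>+\<^sub>1(s)\<close>,
  which survives.\<close>

lemma finite_part_Suc:
  fixes M :: nat
  defines "s \<equiv> of_nat (2 * M + 1) :: complex"
  shows "s * (s + 1) * finite_part (Suc M) = (of_real pi)\<^sup>2 * s\<^sup>2 * finite_part M - alpha (Suc M) s"
proof -
  define c where "c = (of_real pi :: complex)\<^sup>2 * s\<^sup>2"
  define t where "t n = alpha n s * (1/4) ^ n / (2 * (of_nat n - of_nat M))" for n
  define t' where "t' n = alpha n (s + 2) * (1/4) ^ n / (2 * (of_nat n - of_nat (Suc M)))" for n
  have s2: "of_nat (2 * Suc M + 1) = s + 2" by (simp add: s_def)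
  have t: "t sums suminf t" and t': "t' sums suminf t'"
    unfolding t_def[abs_def] t'_def[abs_def] by (rule summable_sums[OF summable_finite_part])+
  have "(\<lambda>n. c / 4 * (case n of 0 \<Rightarrow> 0 | Suc n \<Rightarrow> t n)) sums (c / 4 * suminf t)"
    using sums_mult[OF sums_Suc[of "case_nat 0 t"], of "suminf t" "c / 4"] t by simp
  moreover have "(\<lambda>n. (2 * of_nat n - s) * alpha n s * (1/4) ^ n
      - (if n = Suc M then alpha (Suc M) s * (1/4) ^ Suc M else 0))
      sums (0 - alpha (Suc M) s * (1/4) ^ Suc M)"
    by (intro sums_diff alpha_quarter_derivative_sums sums_single)
  ultimately have "(\<lambda>n. c / 4 * (case n of 0 \<Rightarrow> 0 | Suc n \<Rightarrow> t n) + ((2 * of_nat n - s) * alpha n s * (1/4) ^ n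
      - (if n = Suc M then alpha (Suc M) s * (1/4) ^ Suc M else 0))) sums
      (c / 4 * suminf t + (0 - alpha (Suc M) s * (1/4) ^ Suc M))"
    by (rule sums_add)
  moreover have "c / 4 * (case n of 0 \<Rightarrow> 0 | Suc n \<Rightarrow> t n) + ((2 * of_nat n - s) * alpha n s * (1/4) ^ n
      - (if n = Suc M then alpha (Suc M) s * (1/4) ^ Suc M else 0)) = s * (s + 1) * t' n" for n
  proof (cases n)
    case 0
    have "t' 0 = 1 / (2 * (of_nat 0 - of_nat (Suc M)))"
      by (simp only: t'_def alpha_0 power_0 mult_1)
    also have "2 * (of_nat 0 - of_nat (Suc M)) = - (s + 1)" by (simp add: s_def)
    finally have t'0: "t' 0 = - (1 / (s + 1))" by (simp only: divide_minus_right)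
    have "s + 1 \<noteq> 0"
      using of_nat_neq_0[of "2 * M + 1", where 'a = complex] by (simp add: s_def algebra_simps)
    then show ?thesis by (simp add: 0 t'0)
  next
    case (Suc k)
    have rec: "(2 * of_nat n - s) * (2 * of_nat n - s - 1) * alpha n s =
       s * (s + 1) * alpha n (s + 2) - c * alpha k s"
      using alpha_recurrence[of k s] by (simp add: Suc c_def)
    show ?thesis
    proof (cases "n = Suc M")
      case True
      then show ?thesis by (simp add: t_def t'_def s_def)
    next
      case False
      define d :: complex where "d = 2 * (of_nat n - of_nat (Suc M))"
      have d: "d \<noteq> 0" "2 * of_nat n - s - 1 = d" "2 * (of_nat k - of_nat M) = d"
        using False by (auto simp: d_def s_def Suc)
      have "s * (s + 1) * t' n = s * (s + 1) * alpha n (s + 2) * (1/4) ^ n / d"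
        by (simp add: t'_def d_def)
      also have "s * (s + 1) * alpha n (s + 2) = (2 * of_nat n - s) * d * alpha n s + c * alpha k s"
        using rec unfolding d by simp
      also have "(\<dots>) * (1/4) ^ n / d = (2 * of_nat n - s) * alpha n s * (1/4) ^ n + c * alpha k s * (1/4) ^ n / d"
        using d(1) by (simp add: field_simps)
      finally have t'n: "s * (s + 1) * t' n = (2 * of_nat n - s) * alpha n s * (1/4) ^ n + c * alpha k s * (1/4) ^ n / d" .
      have tk: "t k = alpha k s * (1/4) ^ k / d"
        unfolding t_def d(3) ..
      have "c * alpha k s * (1/4) ^ n / d = c / 4 * t k"
        by (simp add: tk Suc)
      then show ?thesis
        unfolding t'n using False by (simp add: Suc)
    qed
  qed
  ultimately have "(\<lambda>n. s * (s + 1) * t' n) sums (c / 4 * suminf t + (0 - alpha (Suc M) s * (1/4) ^ Suc M))"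
    by simp
  moreover have "(\<lambda>n. s * (s + 1) * t' n) sums (s * (s + 1) * suminf t')"
    using t' by (rule sums_mult)
  ultimately have A: "s * (s + 1) * suminf t' = c / 4 * suminf t - alpha (Suc M) s * (1/4) ^ Suc M"
    by (simp add: sums_unique2)
  have "4 ^ Suc M * (s * (s + 1) * suminf t') = c * 4 ^ M * suminf t - alpha (Suc M) s"
    unfolding A by (simp add: algebra_simps power_divide)
  moreover have "s * (s + 1) * alpha (Suc M) (s + 2) = c * alpha M s"
    using alpha_recurrence[of M s] by (simp add: c_def s_def)
  then have "s * (s + 1) * (alpha (Suc M) (s + 2) * of_real (ln 2)) = c * (alpha M s * of_real (ln 2))"
    by (metis mult.assoc)
  ultimately have "s * (s + 1) * (- alpha (Suc M) (s + 2) * of_real (ln 2) + 4 ^ Suc M * suminf t') =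
     c * (- alpha M s * of_real (ln 2) + 4 ^ M * suminf t) - alpha (Suc M) s"
    by (simp add: algebra_simps)
  moreover have "finite_part (Suc M) = - alpha (Suc M) (s + 2) * of_real (ln 2) + 4 ^ Suc M * suminf t'"
    unfolding finite_part_def s2 t'_def[abs_def] ..
  moreover have "finite_part M = - alpha M s * of_real (ln 2) + 4 ^ M * suminf t"
    unfolding finite_part_def s_def[symmetric] t_def[abs_def] ..
  ultimately show ?thesis
    by (simp only: c_def)
qed

text \<open>A primitive of \<open>(\<pi> / sin (\<pi> z) - 1/z)\<close> is \<open>ln (tan (\<pi> z / 2) / (\<pi> z / 2))\<close>, and
  \<open>tan (\<pi> z / 2) / (\<pi> z / 2) = sinc\<^sup>2 (z / 2) / sinc z\<close>. Written as \<open>K\<close> below it is a holomorphic function on the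
  unit disc, whose power series can be evaluated at \<open>1/2\<close>.\<close>

lemma finite_part_0: "finite_part 0 = of_real (ln 2 - ln pi)"
proof -
  define K where "K z = 2 * log_sinc (z / 2) - log_sinc z" for z
  have half: "z / 2 \<in> ball 0 1" if "z \<in> ball 0 1" for z :: complex
    using that by (simp add: norm_divide)
  have K: "K holomorphic_on ball 0 1"
    unfolding K_def by (intro holomorphic_intros holomorphic_on_compose_gen[OF _ log_sinc_holomorphic, unfolded o_def]
        log_sinc_holomorphic) (use half in auto)
  define F where "F = fps_expansion K 0"
  have KF: "K has_fps_expansion F"
    unfolding F_def by (rule has_fps_expansion_fps_expansion[OF open_ball _ K]) simp
  have zK: "(\<lambda>z. z * deriv K z) has_fps_expansion fps_X * fps_deriv F"
    by (intro fps_expansion_intros KF)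
  have "(\<lambda>z. sinc_neg_power 1 z - 1) has_fps_expansion sinc_pow_fps 1 - 1"
    by (intro fps_expansion_intros sinc_neg_power_has_fps_expansion)
  moreover have ev: "eventually (\<lambda>z. z \<in> ball 0 1) (nhds (0::complex))"
    by (intro eventually_nhds_in_open) auto
  have deriv_K: "eventually (\<lambda>z. z * deriv K z = sinc_neg_power 1 z - 1) (nhds 0)"
    using ev
  proof eventually_elim
    case (elim z)
    show ?case
    proof (cases "z = 0")
      case True
      then show ?thesis by (simp add: sinc_neg_power_def log_sinc_0)
    next
      case False
      define w where "w = of_real pi * z / 2"
      have w_simps [simp]: "of_real pi * z = 2 * w" "of_real pi * (z / 2) = w" by (simp_all add: w_def)
      have sin: "sin (2 * w) \<noteq> 0"
        using sinc_pi_nonzero[OF elim] False by (simp add: sinc_pi_def)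
      then have sc: "sin w \<noteq> 0" "cos w \<noteq> 0" by (auto simp: sin_double)
      have "((\<lambda>z. log_sinc (z / 2)) has_field_derivative
          (of_real pi * cos (of_real pi * (z / 2)) / sin (of_real pi * (z / 2)) - 1 / (z / 2)) * (1 / 2)) (at z)"
        by (rule DERIV_chain2[OF log_sinc_has_field_derivative])
           (use elim False half in \<open>auto intro!: derivative_eq_intros\<close>)
      then have "(K has_field_derivative 2 * ((of_real pi * cos w / sin w - 1 / (z / 2)) * (1 / 2))
          - (of_real pi * cos (2 * w) / sin (2 * w) - 1 / z)) (at z)"
        using DERIV_diff[OF DERIV_cmult log_sinc_has_field_derivative[OF elim False], of "\<lambda>z. log_sinc (z / 2)" _ 2]
        unfolding K_def w_simps by blast
      then have "z * deriv K z = z * (2 * ((of_real pi * cos w / sin w - 1 / (z / 2)) * (1 / 2))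
          - (of_real pi * cos (2 * w) / sin (2 * w) - 1 / z))"
        by (simp add: DERIV_imp_deriv)
      also have "\<dots> = 2 * w * (cos w / sin w - cos (2 * w) / sin (2 * w)) - 1"
        using False by (simp add: w_def field_simps)
      also have "cos w / sin w - cos (2 * w) / sin (2 * w) = 1 / sin (2 * w)"
      proof -
        have eq: "cos w / sin w = 2 * (cos w)\<^sup>2 / (2 * sin w * cos w)"
          using sc by (simp add: power2_eq_square)
        show ?thesis
          unfolding sin_double cos_double_cos eq diff_divide_distrib[symmetric] by simp
      qed
      also have "2 * w * (1 / sin (2 * w)) - 1 = sinc_neg_power 1 z - 1"
        using elim False by (simp add: sinc_neg_power_def exp_minus exp_log_sinc sinc_pi_def)
      finally show ?thesis .
    qed
  qed
  ultimately have "(\<lambda>z. z * deriv K z) has_fps_expansion sinc_pow_fps 1 - 1"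
    using has_fps_expansion_cong[OF deriv_K refl] by simp
  then have ODE: "fps_X * fps_deriv F = sinc_pow_fps 1 - 1"
    by (rule fps_expansion_unique_complex[OF zK])
  have F_nth: "of_nat k * F $ k = (sinc_pow_fps 1 - 1) $ k" for k
    using fps_theta_nth[of F k] unfolding ODE by simp
  have F0: "F $ 0 = 0"
    using has_fps_expansion_imp_0_eq_fps_nth_0[OF KF] by (simp add: K_def log_sinc_0)
  have F_odd: "F $ k = 0" if "odd k" for k
  proof -
    have "of_nat k * F $ k = 0"
      using F_nth[of k] that by (cases "k = 0") (auto simp: sinc_pow_fps_eq_alpha)
    then show ?thesis
      using that by (cases "k = 0") simp_all
  qed
  have F_even: "F $ (2 * n) = (if n = 0 then 0 else alpha n 1 / (2 * of_nat n))" for n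
    using F_nth[of "2 * n"] F0 by (auto simp: alpha_eq_nth field_simps)
  have "(\<lambda>n. F $ n * (1/2) ^ n) sums K (1/2)"
    by (rule has_fps_expansion_imp_sums_complex[where r = "ereal 1", OF KF]) (use K in auto)
  also have "?this \<longleftrightarrow> (\<lambda>n. F $ (2 * n) * (1/2) ^ (2 * n)) sums K (1/2)"
    by (rule sums_mono_reindex[symmetric]) (auto simp: strict_mono_def intro!: F_odd elim!: evenE)
  also have "(\<lambda>n. F $ (2 * n) * (1/2) ^ (2 * n)) = (\<lambda>n. alpha n 1 * (1/4) ^ n / (2 * of_nat n))"
    by (simp add: fun_eq_iff F_even power_mult power2_eq_square)
  finally have "(\<lambda>n. alpha n 1 * (1/4) ^ n / (2 * of_nat n)) sums K (1/2)" .
  moreover have "K (1/2) = of_real (2 * ln 2 - ln pi)"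
  proof -
    have "log_sinc (1/2) = of_real (ln (2 / pi))"
      using log_sinc_of_real[of "1/2"] by simp
    moreover have "log_sinc (1/4) = of_real (ln (sqrt 2 / 2 * 4 / pi))"
      using log_sinc_of_real[of "1/4"] by (simp add: sin_45)
    ultimately have "K (1/2) = of_real (2 * ln (sqrt 2 / 2 * 4 / pi) - ln (2 / pi))"
      by (simp add: K_def)
    also have "2 * ln (sqrt 2 / 2 * 4 / pi) - ln (2 / pi) = 2 * ln 2 - ln pi"
    proof -
      have "ln 4 = 2 * ln (2::real)"
        using ln_realpow[of 2 2] by simp
      then show ?thesis
        by (simp add: ln_div ln_mult ln_sqrt)
    qed
    finally show ?thesis .
  qed
  ultimately show ?thesis
    by (simp add: finite_part_def sums_iff)
qed

text \<open>Induction on \<open>M\<close>. The term \<open>\<alpha>\<^sub>M\<^sub>+\<^sub>1(2 M + 1)\<close> left by the recursion of the finite parts is replaced by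
  means of the differentiated recurrence; what remains is the change of the digamma terms,
  \<open>1/(2 M + 2) - 1/(2 M + 1)\<close>.\<close>

lemma finite_part_eq:
  "finite_part M = alpha M (of_nat (2 * M + 1)) * (C M - of_real (ln pi))"
proof -
  define D :: "nat \<Rightarrow> complex" where "D M = Digamma (of_nat M + 1) / 2 - Digamma (of_nat M + 1/2) / 2" for M
  have nz: "alpha M (of_nat (2 * M + 1)) \<noteq> 0" for M
    unfolding alpha_odd of_real_eq_0_iff using pochhammer_pos[of "1/2::real" M] by simp
  have "finite_part M = deriv (alpha M) (of_nat (2 * M + 1)) + alpha M (of_nat (2 * M + 1)) * (D M - of_real (ln pi))"
  proof (induction M)
    case 0
    have "deriv (alpha 0) 1 = 0"
    proof -
      have "alpha 0 = (\<lambda>_. 1)" by auto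
      then show ?thesis by simp
    qed
    moreover have "D 0 = of_real (ln 2)"
      by (simp add: D_def Digamma_one_half field_simps)
    ultimately show ?case
      by (simp add: finite_part_0)
  next
    case (Suc M)
    define s :: complex where "s = of_nat (2 * M + 1)"
    define A where "A = alpha M s"
    define A' where "A' = alpha (Suc M) (s + 2)"
    define L where "L = D M - of_real (ln pi)"
    have s2: "of_nat (2 * Suc M + 1) = s + 2" by (simp add: s_def)
    have s: "s \<noteq> 0" "s + 1 \<noteq> 0"
      using of_nat_neq_0[of "2 * M", where 'a = complex] of_nat_neq_0[of "2 * M + 1", where 'a = complex]
      by (simp_all add: s_def algebra_simps)
    have D_Suc: "D (Suc M) = D M - 1 / (s * (s + 1))"
    proof -
      have M: "of_nat M = (s - 1) / 2" by (simp add: s_def)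
      have "Digamma (of_nat M + 1 + 1) = Digamma (of_nat M + 1) + 1 / (of_nat M + 1 :: complex)"
        by (rule Digamma_plus1) (metis of_nat_Suc of_nat_neq_0 add.commute)
      moreover have "Digamma (of_nat M + 1/2 + 1) = Digamma (of_nat M + 1/2) + 1 / (of_nat M + 1/2 :: complex)"
        by (rule Digamma_plus1) (use s in \<open>simp add: M field_simps\<close>)
      ultimately have "D (Suc M) = D M + (1 / (of_nat M + 1) - 1 / (of_nat M + 1/2)) / 2"
        by (simp add: D_def add_ac diff_divide_distrib add_divide_distrib)
      also have "\<dots> = D M - 1 / (s * (s + 1))"
      proof -
        have "of_nat M + 1 = (s + 1) / 2" "of_nat M + 1/2 = s / 2" by (simp_all add: M field_simps)
        then show ?thesis using s by (simp only:) (simp add: diff_divide_distrib diff_frac_eq mult.commute)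
      qed
      finally show ?thesis .
    qed
    have A': "s * (s + 1) * A' = (of_real pi)\<^sup>2 * s\<^sup>2 * A"
      using alpha_recurrence[of M s] by (simp add: A_def A'_def s_def)
    have "s * (s + 1) * finite_part (Suc M) =
      (of_real pi)\<^sup>2 * s\<^sup>2 * (deriv (alpha M) s + A * L)
      + ((2 * s + 1) * A' + s * (s + 1) * deriv (alpha (Suc M)) (s + 2)
      - (of_real pi)\<^sup>2 * (2 * s * A + s\<^sup>2 * deriv (alpha M) s))"
      unfolding finite_part_Suc[of M, folded s_def] Suc[folded s_def]
        alpha_derivative_recurrence[of M, folded s_def, folded A_def A'_def, symmetric]
      by (simp add: A_def L_def)
    also have "\<dots> = s * (s + 1) * deriv (alpha (Suc M)) (s + 2)
        + (of_real pi)\<^sup>2 * s\<^sup>2 * A * L + (2 * s + 1) * A' - 2 * ((of_real pi)\<^sup>2 * s * A)"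
      by (simp add: algebra_simps)
    also have "(of_real pi)\<^sup>2 * s * A = (s + 1) * A'"
      using A' s(1) by (simp add: power2_eq_square)
    also have "(of_real pi)\<^sup>2 * s\<^sup>2 * A = s * (s + 1) * A'" by (rule A'[symmetric])
    also have "s * (s + 1) * deriv (alpha (Suc M)) (s + 2) + s * (s + 1) * A' * L + (2 * s + 1) * A' - 2 * ((s + 1) * A')
       = s * (s + 1) * (deriv (alpha (Suc M)) (s + 2) + A' * (L - 1 / (s * (s + 1))))"
    proof -
      have "q * (X + A' * (L - 1 / q)) = q * X + q * A' * L - A'" if "q \<noteq> 0" for q X
        using that by (simp add: algebra_simps)
      moreover have "s * (s + 1) \<noteq> 0" using s by simp
      ultimately have "s * (s + 1) * (X + A' * (L - 1 / (s * (s + 1)))) =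
          s * (s + 1) * X + s * (s + 1) * A' * L - A'" for X by blast
      then show ?thesis by (simp only:) (simp add: algebra_simps)
    qed
    finally have "finite_part (Suc M) = deriv (alpha (Suc M)) (s + 2) + A' * (L - 1 / (s * (s + 1)))"
      using s by simp
    then show ?case
      unfolding s2 D_Suc by (simp add: A'_def L_def algebra_simps)
  qed
  moreover have "C M = deriv (alpha M) (of_nat (2 * M + 1)) / alpha M (of_nat (2 * M + 1)) + D M"
    unfolding C_def D_def by (rule add_diff_eq[symmetric])
  moreover have "a * (x / a + D - l) = x + a * (D - l)" if "a \<noteq> 0" for a x D l :: complex
    using that by (simp add: right_diff_distrib distrib_left)
  from this[OF nz] have "alpha M (of_nat (2 * M + 1)) * (deriv (alpha M) (of_nat (2 * M + 1)) /
      alpha M (of_nat (2 * M + 1)) + D M - of_real (ln pi)) =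
      deriv (alpha M) (of_nat (2 * M + 1)) + alpha M (of_nat (2 * M + 1)) * (D M - of_real (ln pi))" .
  ultimately show ?thesis
    by (simp only:)
qed

section \<open>Midpoint sums\<close>

lemma midpoint_rule_error:
  fixes F g g' g'' :: "real \<Rightarrow> real"
  assumes "d > 0"
    and F: "\<And>x. x \<in> {c - d..c + d} \<Longrightarrow> (F has_real_derivative g x) (at x)"
    and g: "\<And>x. x \<in> {c - d..c + d} \<Longrightarrow> (g has_real_derivative g' x) (at x)"
    and g': "\<And>x. x \<in> {c - d..c + d} \<Longrightarrow> (g' has_real_derivative g'' x) (at x)"
    and B: "\<And>x. x \<in> {c - d..c + d} \<Longrightarrow> \<bar>g'' x\<bar> \<le> B"
  shows "\<bar>2 * d * g c - (F (c + d) - F (c - d))\<bar> \<le> B * d ^ 3 / 3"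
proof -
  define D where "D n = [F, g, g', g''] ! n" for n
  have D0: "D 0 = F" by (simp add: D_def)
  have D: "\<forall>m t. m < 3 \<and> c - d \<le> t \<and> t \<le> c + d \<longrightarrow> (D m has_real_derivative D (Suc m) t) (at t)"
  proof (intro allI impI)
    fix m :: nat and t assume *: "m < 3 \<and> c - d \<le> t \<and> t \<le> c + d"
    then consider "m = 0" | "m = 1" | "m = 2" by linarith
    then show "(D m has_real_derivative D (Suc m) t) (at t)"
      using * F g g' by cases (auto simp: D_def)
  qed
  obtain t where t: "c < t" "t < c + d"
    and up: "F (c + d) = (\<Sum>m<3. D m c / fact m * (c + d - c) ^ m) + D 3 t / fact 3 * (c + d - c) ^ 3"
    using Taylor_up[OF _ D0 D, of c] \<open>d > 0\<close> by auto
  obtain u where u: "c - d < u" "u < c"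
    and down: "F (c - d) = (\<Sum>m<3. D m c / fact m * (c - d - c) ^ m) + D 3 u / fact 3 * (c - d - c) ^ 3"
    using Taylor_down[OF _ D0 D, of c] \<open>d > 0\<close> by auto
  have "2 * d * g c - (F (c + d) - F (c - d)) = - (g'' t + g'' u) * d ^ 3 / 6"
    unfolding up down by (simp add: D_def eval_nat_numeral field_simps)
  also have "\<bar>\<dots>\<bar> = \<bar>g'' t + g'' u\<bar> * d ^ 3 / 6"
    using \<open>d > 0\<close> by (simp add: abs_mult)
  also have "\<dots> \<le> (2 * B) * d ^ 3 / 6"
    using \<open>d > 0\<close> B[of t] B[of u] t u by (intro divide_right_mono mult_right_mono) auto
  finally show ?thesis by simp
qed

lemma sum_inverse_square_le:
  fixes q :: nat
  assumes "q > 0"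
  shows "(\<Sum>j=q..<r. 1 / (real j)\<^sup>2) \<le> 2 / real q"
proof -
  have "(\<Sum>j=q..<r. 1 / (real j)\<^sup>2) \<le> 2 / real q - 2 / real r" if "q \<le> r"
    using that
  proof (induction rule: dec_induct)
    case (step r)
    then have r: "real r \<ge> 1" using assms by linarith
    have "1 / (real r)\<^sup>2 \<le> 2 / real r - 2 / real (Suc r)"
    proof -
      have "1 / (real r)\<^sup>2 = 2 / (2 * (real r)\<^sup>2)" by simp
      also have "\<dots> \<le> 2 / (real r * (real r + 1))"
      proof (rule divide_left_mono)
        have "real r * 1 \<le> real r * real r" using r by (intro mult_left_mono) auto
        then show "real r * (real r + 1) \<le> 2 * (real r)\<^sup>2"
          by (simp add: power2_eq_square algebra_simps)
        show "0 < 2 * (real r)\<^sup>2 * (real r * (real r + 1))"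
          using r by (intro mult_pos_pos) auto
      qed simp
      also have "\<dots> = 2 / real r - 2 / real (Suc r)"
        using r by (simp add: field_simps)
      finally show ?thesis .
    qed
    with step show ?case by simp
  qed simp
  moreover have "2 / real r \<ge> 0" "2 / real q \<ge> 0" by simp_all
  ultimately show ?thesis
    by (cases "q \<le> r") (linarith, simp)
qed

text \<open>Comparison with \<open>1/j\<^sup>2\<close>, whose tails telescope against \<open>2/j\<close>; a factor \<open>2\<close> above the integral is good enough.\<close>

lemma sum_powr_tail_le:
  fixes q :: nat and p :: real
  assumes "q > 0" "p \<ge> 2"
  shows "(\<Sum>j=q..<r. real j powr (- p)) \<le> 2 * real q powr (1 - p)"
proof -
  have "(\<Sum>j=q..<r. real j powr (- p)) \<le> (\<Sum>j=q..<r. real q powr (2 - p) * (1 / (real j)\<^sup>2))"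
  proof (rule sum_mono)
    fix j assume "j \<in> {q..<r}"
    then have j: "real q \<le> real j" "real j > 0" using assms by auto
    have "real j powr (- p) = real j powr (2 - p) * real j powr (- 2)"
      by (simp add: powr_add[symmetric])
    also have "\<dots> \<le> real q powr (2 - p) * real j powr (- 2)"
      using j assms by (intro mult_right_mono powr_mono2') auto
    also have "real j powr (- 2) = 1 / (real j)\<^sup>2"
      using j by (simp add: powr_minus divide_inverse)
    finally show "real j powr (- p) \<le> real q powr (2 - p) * (1 / (real j)\<^sup>2)" .
  qed
  also have "\<dots> = real q powr (2 - p) * (\<Sum>j=q..<r. 1 / (real j)\<^sup>2)"
    by (rule sum_distrib_left[symmetric])
  also have "\<dots> \<le> real q powr (2 - p) * (2 / real q)"
    by (intro mult_left_mono sum_inverse_square_le assms) simp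
  also have "\<dots> = 2 * real q powr (1 - p)"
  proof -
    have "real q powr (2 - p) = real q powr (1 - p) * real q powr 1"
      by (simp only: powr_add[symmetric]) simp
    then show ?thesis using assms by simp
  qed
  finally show ?thesis .
qed

text \<open>The zeta function for real \<open>p > 1\<close>; it allows the whole asymptotic analysis to take place in the reals.\<close>

definition real_zeta :: "real \<Rightarrow> real" where
  "real_zeta p = (\<Sum>n. real (Suc n) powr (- p))"

lemma real_zeta_summable: "p > 1 \<Longrightarrow> summable (\<lambda>n. real (Suc n) powr (- p))"
  using summable_real_powr_iff[of "- p"] by (subst summable_Suc_iff) simp

lemma zeta_of_real:
  assumes "p > 1"
  shows "zeta (of_real p) = of_real (real_zeta p)"
proof -
  have "1 / of_nat (Suc n) powr complex_of_real p = of_real (real (Suc n) powr (- p))" for n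
  proof -
    have "of_nat (Suc n) powr complex_of_real p = of_real (real (Suc n) powr p)"
      using powr_of_real[of "real (Suc n)" p] by simp
    then show ?thesis by (simp add: powr_minus divide_inverse)
  qed
  then show ?thesis
    unfolding zeta_def real_zeta_def using suminf_of_real[OF real_zeta_summable[OF assms], where 'a = complex] by simp
qed

lemma odd_zeta_LIMSEQ:
  assumes p: "p > 1"
  shows "(\<lambda>r. \<Sum>j<r. real (2 * j + 1) powr (- p)) \<longlonglongrightarrow> (1 - 2 powr (- p)) * real_zeta p"
proof -
  define Z where "Z r = (\<Sum>n<r. real (Suc n) powr (- p))" for r
  have Z: "Z \<longlonglongrightarrow> real_zeta p"
    unfolding Z_def real_zeta_def by (rule summable_LIMSEQ[OF real_zeta_summable[OF p]])
  have split: "(\<Sum>j<r. real (2 * j + 1) powr (- p)) = Z (2 * r) - 2 powr (- p) * Z r" for r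
  proof (induction r)
    case (Suc r)
    have "real (2 * r + 2) powr (- p) = 2 powr (- p) * real (Suc r) powr (- p)"
      by (subst powr_mult[symmetric]) (simp add: algebra_simps)
    with Suc show ?case by (simp add: Z_def algebra_simps)
  qed (simp add: Z_def)
  have "strict_mono (\<lambda>r::nat. 2 * r)" by (simp add: strict_mono_def)
  from LIMSEQ_subseq_LIMSEQ[OF Z this] have "(\<lambda>r. Z (2 * r)) \<longlonglongrightarrow> real_zeta p"
    by (simp add: o_def)
  then have "(\<lambda>r. Z (2 * r) - 2 powr (- p) * Z r) \<longlonglongrightarrow> real_zeta p - 2 powr (- p) * real_zeta p"
    by (intro tendsto_intros Z)
  then show ?thesis
    unfolding split by (simp add: algebra_simps)
qed

text \<open>The term at \<open>2 j + 1\<close> is half the integral of \<open>x\<^sup>-\<^sup>p\<close> over \<open>[2 j, 2 j + 2]\<close> up to the error of the midpoint rule,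
  which is \<open>O(j^(- p - 2))\<close>. Summing over \<open>j \<ge> q\<close> gives the tail of the odd zeta series to the required precision.\<close>

lemma sum_odd_powr_asymptotic:
  assumes p: "p > 1" and q: "q > 0"
  shows "\<bar>(\<Sum>j<q. real (2 * j + 1) powr (- p)) -
           ((1 - 2 powr (- p)) * real_zeta p - (2 * real q) powr (1 - p) / (2 * (p - 1)))\<bar>
         \<le> p * (p + 1) * real q powr (- p - 1)"
proof -
  \<comment> \<open>\<open>T x\<close> is half the integral of \<open>x\<^sup>-\<^sup>p\<close> from \<open>x\<close> to infinity.\<close>
  define T where "T x = x powr (1 - p) / (2 * (p - 1))" for x
  define S where "S r = (\<Sum>j<r. real (2 * j + 1) powr (- p))" for r
  have term_err: "\<bar>real (2 * j + 1) powr (- p) - (T (real (2 * j)) - T (real (2 * Suc j)))\<bar>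
      \<le> p * (p + 1) / 2 * real j powr (- p - 2)" if j: "j > 0" for j
  proof -
    define B where "B = p * (p + 1) * real (2 * j) powr (- p - 2)"
    have "\<bar>2 * 1 * (real (2 * j + 1) powr (- p)) - (- 2 * T (real (2 * j + 1) + 1) - (- 2 * T (real (2 * j + 1) - 1)))\<bar>
        \<le> B * 1 ^ 3 / 3"
    proof (rule midpoint_rule_error[where g' = "\<lambda>x. - p * x powr (- p - 1)" and g'' = "\<lambda>x. p * (p + 1) * x powr (- p - 2)"])
      fix x assume x: "x \<in> {real (2 * j + 1) - 1..real (2 * j + 1) + 1}"
      then have x': "x \<ge> real (2 * j)" "x > 0" using j by auto
      show "((\<lambda>x. - 2 * T x) has_real_derivative x powr (- p)) (at x)"
      proof -
        have "- 2 * T x = x powr (1 - p) / (1 - p)" for x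
        proof -
          have "- 2 * (y / (2 * e)) = - (y / e)" for y e :: real by simp
          then have "- 2 * T x = - (x powr (1 - p) / (p - 1))" unfolding T_def .
          then show ?thesis by (metis minus_diff_eq minus_divide_right)
        qed
        then show ?thesis
          using x' p by (auto intro!: derivative_eq_intros)
      qed
      show "((\<lambda>x. x powr (- p)) has_real_derivative - p * x powr (- p - 1)) (at x)"
        using x' p by (auto intro!: derivative_eq_intros)
      show "((\<lambda>x. - p * x powr (- p - 1)) has_real_derivative p * (p + 1) * x powr (- p - 2)) (at x)"
        using x' p by (auto intro!: derivative_eq_intros simp: algebra_simps)
      show "\<bar>p * (p + 1) * x powr (- p - 2)\<bar> \<le> B"
        unfolding B_def using x' j p by (simp add: abs_mult) (intro powr_mono2', auto)
    qed simp
    moreover have "B \<le> p * (p + 1) * real j powr (- p - 2)"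
      unfolding B_def using j p by (intro mult_left_mono powr_mono2') auto
    moreover have "real (2 * j + 1) + 1 = real (2 * Suc j)" "real (2 * j + 1) - 1 = real (2 * j)" by simp_all
    moreover have "B \<ge> 0" using p by (simp add: B_def)
    moreover have "\<bar>a - (t - u)\<bar> \<le> K / 2"
      if "\<bar>2 * 1 * a - (- 2 * u - (- 2 * t))\<bar> \<le> B * 1 ^ 3 / 3" "B \<le> K" "0 \<le> B" for a t u K :: real
      using that unfolding power_one mult_1_right by linarith
    ultimately have "\<bar>real (2 * j + 1) powr (- p) - (T (real (2 * j)) - T (real (2 * Suc j)))\<bar>
      \<le> p * (p + 1) * real j powr (- p - 2) / 2" by (simp only:)
    then show ?thesis by simp
  qed
  have diff: "\<bar>S r - S q - (T (real (2 * q)) - T (real (2 * r)))\<bar> \<le> p * (p + 1) * real q powr (- p - 1)"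
    if r: "r \<ge> q" for r
  proof -
    have "S r - S q - (T (real (2 * q)) - T (real (2 * r))) =
        (\<Sum>j=q..<r. real (2 * j + 1) powr (- p) - (T (real (2 * j)) - T (real (2 * Suc j))))"
      using r by (induction rule: dec_induct) (simp_all add: S_def)
    also have "\<bar>\<dots>\<bar> \<le> (\<Sum>j=q..<r. p * (p + 1) / 2 * real j powr (- p - 2))"
      using q by (intro order_trans[OF sum_abs] sum_mono term_err) auto
    also have "\<dots> = p * (p + 1) / 2 * (\<Sum>j=q..<r. real j powr (- (p + 2)))"
      by (simp add: sum_distrib_left)
    also have "\<dots> \<le> p * (p + 1) / 2 * (2 * real q powr (1 - (p + 2)))"
      using p q by (intro mult_left_mono sum_powr_tail_le) auto
    also have "1 - (p + 2) = - p - 1" by simp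
    finally have "\<bar>S r - S q - (T (real (2 * q)) - T (real (2 * r)))\<bar> \<le>
        p * (p + 1) / 2 * (2 * real q powr (- p - 1))" .
    also have "\<dots> = p * (p + 1) * real q powr (- p - 1)" by simp
    finally show ?thesis .
  qed
  have "(\<lambda>r. T (real (2 * r))) \<longlonglongrightarrow> 0"
  proof -
    have "filterlim (\<lambda>r. real (2 * r)) at_top sequentially"
      by (rule filterlim_compose[OF filterlim_real_sequentially]) (rule mult_nat_left_at_top, simp)
    then have "(\<lambda>r. real (2 * r) powr (1 - p)) \<longlonglongrightarrow> 0"
      using p by (intro tendsto_neg_powr) auto
    from tendsto_divide_zero[OF this] show ?thesis unfolding T_def .
  qed
  moreover have "S \<longlonglongrightarrow> (1 - 2 powr (- p)) * real_zeta p"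
    unfolding S_def by (rule odd_zeta_LIMSEQ[OF p])
  ultimately have "(\<lambda>r. \<bar>S r - S q - (T (real (2 * q)) - T (real (2 * r)))\<bar>) \<longlonglongrightarrow>
      \<bar>(1 - 2 powr (- p)) * real_zeta p - S q - (T (real (2 * q)) - 0)\<bar>"
    by (intro tendsto_intros)
  then have "\<bar>(1 - 2 powr (- p)) * real_zeta p - S q - (T (real (2 * q)) - 0)\<bar> \<le> p * (p + 1) * real q powr (- p - 1)"
    by (rule LIMSEQ_le_const2) (use diff in auto)
  then show ?thesis
    unfolding S_def T_def by simp
qed

lemma harm_asymptotic:
  assumes "n > 0"
  shows "\<bar>harm n - (ln (real n) + euler_mascheroni + 1 / (2 * real n))\<bar> \<le> 1 / (real n)\<^sup>2"
proof (cases "n = 1")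
  case True
  have "(euler_mascheroni :: real) < 1" "(euler_mascheroni :: real) > 0"
    using euler_mascheroni_less_13_over_22 euler_mascheroni_pos by linarith+
  moreover have "(harm n :: real) = 1" "ln (real n) = 0" "1 / (2 * real n) = 1 / 2" "1 / (real n)\<^sup>2 = 1"
    using True by (simp_all add: harm_def)
  ultimately show ?thesis by linarith
next
  case False
  then obtain k where n: "n = Suc k" and k: "k \<ge> 1"
    using assms by (cases n) auto
  have "(euler_mascheroni :: real) \<ge> harm k - ln (real n) + 1 / (2 * real n)"
    "(euler_mascheroni :: real) \<le> harm k - ln (real n) + 1 / (2 * real k)"
    using euler_mascheroni_bounds[OF k] unfolding n inverse_eq_divide by simp_all
  moreover have "(harm n :: real) = harm k + 1 / real n"
    by (simp add: n harm_Suc divide_inverse)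
  moreover have "1 / (2 * real k) \<le> 1 / (2 * real n) + 1 / (real n)\<^sup>2"
  proof -
    have "1 / (2 * x) \<le> 1 / (2 * (x + 1)) + 1 / (x + 1)\<^sup>2" if x: "x \<ge> 1" for x :: real
    proof -
      have "1 / (2 * x) = 1 / (2 * (x + 1)) + 1 / (2 * x * (x + 1))"
        using x by (simp add: divide_simps) (simp add: algebra_simps)
      also have "1 / (2 * x * (x + 1)) \<le> 1 / (x + 1)\<^sup>2"
      proof (rule divide_left_mono)
        have "(x + 1) * (x + 1) \<le> 2 * x * (x + 1)"
          using x by (intro mult_right_mono) linarith+
        then show "(x + 1)\<^sup>2 \<le> 2 * x * (x + 1)" by (simp only: power2_eq_square)
        show "0 < 2 * x * (x + 1) * (x + 1)\<^sup>2"
          using x by (intro mult_pos_pos zero_less_power) linarith+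
      qed simp
      finally show ?thesis by simp
    qed
    from this[of "real k"] k show ?thesis by (simp add: n add.commute)
  qed
  moreover have "1 / real n = 2 * (1 / (2 * real n))" by simp
  ultimately show ?thesis by linarith
qed

text \<open>The odd harmonic sum is \<open>harm (2 q) - harm q / 2\<close>, in which the terms of order \<open>1/q\<close> cancel.\<close>

lemma sum_odd_reciprocal_asymptotic:
  assumes q: "q > 0"
  shows "\<bar>(\<Sum>j<q. 1 / real (2 * j + 1)) - (ln (real q) / 2 + ln 2 + euler_mascheroni / 2)\<bar> \<le> 1 / (real q)\<^sup>2"
proof -
  have "(\<Sum>j<q. 1 / real (2 * j + 1)) = harm (2 * q) - harm q / 2"
  proof (induction q)
    case (Suc q)
    have "harm (2 * Suc q) = harm (2 * q) + 1 / real (2 * q + 1) + 1 / real (2 * q + 2)"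
      by (simp add: harm_Suc divide_inverse add_ac)
    moreover have "harm (Suc q) = harm q + 1 / real (Suc q)"
      by (simp add: harm_Suc divide_inverse)
    moreover have "1 / real (2 * q + 2) = 1 / real (Suc q) / 2"
      by (simp add: field_simps)
    ultimately show ?case
      unfolding sum.lessThan_Suc Suc.IH by (simp only: add_divide_distrib)
  qed (simp add: harm_def)
  moreover have "\<bar>harm (2 * q) - (ln 2 + ln (real q) + euler_mascheroni + 1 / (2 * real q) / 2)\<bar> \<le> 1 / (real q)\<^sup>2 / 4"
  proof -
    have "ln (real (2 * q)) = ln 2 + ln (real q)"
      using q by (simp add: ln_mult)
    moreover have "1 / (2 * real (2 * q)) = 1 / (2 * real q) / 2" "1 / (real (2 * q))\<^sup>2 = 1 / (real q)\<^sup>2 / 4"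
      by (simp_all add: power2_eq_square)
    moreover have "2 * q > 0" using q by simp
    ultimately show ?thesis
      using harm_asymptotic[of "2 * q"] by (simp only:)
  qed
  moreover have "1 / (real q)\<^sup>2 \<ge> 0" by simp
  moreover note harm_asymptotic[OF q]
  moreover have "\<bar>S - (l / 2 + ln 2 + g / 2)\<bar> \<le> w"
    if "S = h' - h / 2" "\<bar>h' - (ln 2 + l + g + e / 2)\<bar> \<le> w / 4" "w \<ge> 0" "\<bar>h - (l + g + e)\<bar> \<le> w"
    for S h h' l g e w :: real
    using that by linarith
  ultimately show ?thesis by blast
qed

text \<open>The midpoint rule with step \<open>1/(2 q)\<close> for a power series on \<open>[0, 1/2]\<close>, multiplied by \<open>2 q\<close>. Its second derivative is
  bounded there because the series converges on \<open>(-1, 1)\<close>; the last series is the integral.\<close>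

lemma powser_midpoint_sums:
  fixes c :: "nat \<Rightarrow> real"
  assumes c: "\<And>x. \<bar>x\<bar> < 1 \<Longrightarrow> summable (\<lambda>k. c k * x ^ k)"
  shows "\<exists>B. \<forall>q>0. \<bar>(\<Sum>j<q. \<Sum>k. c k * (real (2 * j + 1) / (4 * real q)) ^ k)
                     - 2 * real q * (\<Sum>k. c k * (1/2) ^ Suc k / real (Suc k))\<bar> \<le> B / real q"
proof -
  \<comment> \<open>Coefficients of the primitive that vanishes at \<open>0\<close>.\<close>
  define I where "I k = (case k of 0 \<Rightarrow> 0 | Suc k \<Rightarrow> c k / real (Suc k))" for k
  have diffs_I: "diffs I = c"
    by (simp add: fun_eq_iff diffs_def I_def)
  define P where "P c x = (\<Sum>k. c k * x ^ k :: real)" for c x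
  have I: "summable (\<lambda>k. I k * x ^ k)" if x: "\<bar>x\<bar> < 1" for x
  proof -
    obtain y where y: "\<bar>x\<bar> < y" "y < 1" using dense[OF x] by blast
    have "summable (\<lambda>k. norm (c k * x ^ k))"
      by (rule powser_insidea[OF c[of y]]) (use y in auto)
    then have "summable (\<lambda>k. \<bar>x\<bar> * norm (c k * x ^ k))" by (rule summable_mult)
    then have "summable (\<lambda>k. I (Suc k) * x ^ Suc k)"
    proof (rule summable_comparison_test'[where N = 0])
      fix k
      have "\<bar>c k * x ^ Suc k\<bar> / real (Suc k) \<le> \<bar>c k * x ^ Suc k\<bar> / 1"
        by (intro divide_left_mono) auto
      then show "norm (I (Suc k) * x ^ Suc k) \<le> \<bar>x\<bar> * norm (c k * x ^ k)"
        by (simp add: I_def abs_mult mult_ac)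
    qed
    then show ?thesis by (subst (asm) summable_Suc_iff)
  qed
  have conv: "summable (\<lambda>k. diffs f k * x ^ k)"
    if "\<And>x. \<bar>x\<bar> < 1 \<Longrightarrow> summable (\<lambda>k. f k * x ^ k)" "\<bar>x\<bar> < 1" for f and x :: real
    by (rule termdiff_converges[where K = 1]) (use that in auto)
  have deriv: "(P f has_real_derivative P (diffs f) x) (at x)"
    if "\<And>x. \<bar>x\<bar> < 1 \<Longrightarrow> summable (\<lambda>k. f k * x ^ k)" "\<bar>x\<bar> < 1" for f x
    unfolding P_def by (rule termdiffs_strong'[where K = 1]) (use that in auto)
  have "continuous_on {0..1/2} (P (diffs (diffs c)))"
    by (intro continuous_at_imp_continuous_on ballI DERIV_isCont[OF deriv] conv c) auto
  then have "bounded (P (diffs (diffs c)) ` {0..1/2})"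
    by (intro compact_imp_bounded compact_continuous_image) auto
  then obtain B where "\<forall>y\<in>P (diffs (diffs c)) ` {0..1/2}. norm y \<le> B"
    unfolding bounded_iff by blast
  then have B: "\<bar>P (diffs (diffs c)) x\<bar> \<le> B" if "x \<in> {0..1/2}" for x
    using that by simp
  have main: "\<bar>(\<Sum>j<q. P c (real (2 * j + 1) / (4 * real q))) - 2 * real q * P I (1/2)\<bar> \<le> B / real q" if q: "q > 0" for q
  proof -
    define d where "d = 1 / (4 * real q)"
    have d: "d > 0" using q by (simp add: d_def)
    have err: "\<bar>2 * d * P c (real (2 * j + 1) * d) - (P I (real (2 * Suc j) * d) - P I (real (2 * j) * d))\<bar> \<le> B * d ^ 3 / 3"
      if "j < q" for j
    proof -
      have "real (2 * j + 2) * d \<le> real (2 * q) * d"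
        using that d by (intro mult_right_mono) auto
      also have "\<dots> = 1/2" using q by (simp add: d_def)
      finally have le: "real (2 * j + 1) * d + d \<le> 1/2" by (simp add: algebra_simps)
      have ge: "real (2 * j + 1) * d - d \<ge> 0" using d by (simp add: algebra_simps)
      have "\<bar>2 * d * P c (real (2 * j + 1) * d) - (P I (real (2 * j + 1) * d + d) - P I (real (2 * j + 1) * d - d))\<bar> \<le> B * d ^ 3 / 3"
      proof (rule midpoint_rule_error[OF d, where g' = "P (diffs c)" and g'' = "P (diffs (diffs c))"])
        fix x assume x: "x \<in> {real (2 * j + 1) * d - d..real (2 * j + 1) * d + d}"
        then have x': "x \<in> {0..1/2}" "\<bar>x\<bar> < 1" using le ge by auto
        show "(P I has_real_derivative P c x) (at x)"
          using deriv[OF I x'(2)] by (simp add: diffs_I)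
        show "(P c has_real_derivative P (diffs c) x) (at x)"
          by (intro deriv c x')
        show "(P (diffs c) has_real_derivative P (diffs (diffs c)) x) (at x)"
          by (intro deriv conv c x')
        show "\<bar>P (diffs (diffs c)) x\<bar> \<le> B" by (rule B[OF x'(1)])
      qed
      moreover have "real (2 * j + 1) * d + d = real (2 * Suc j) * d" "real (2 * j + 1) * d - d = real (2 * j) * d"
        by (simp_all add: algebra_simps)
      ultimately show ?thesis by (simp only:)
    qed
    have "(\<Sum>j<q. P I (real (2 * Suc j) * d) - P I (real (2 * j) * d)) = P I (real (2 * q) * d) - P I (real (2 * 0) * d)"
      by (rule sum_lessThan_telescope)
    also have "real (2 * q) * d = 1/2" using q by (simp add: d_def)
    also have "P I (real (2 * 0) * d) = 0"
      by (simp add: P_def I_def)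
    finally have "2 * d * (\<Sum>j<q. P c (real (2 * j + 1) * d)) - P I (1/2) =
        (\<Sum>j<q. 2 * d * P c (real (2 * j + 1) * d) - (P I (real (2 * Suc j) * d) - P I (real (2 * j) * d)))"
      by (simp add: sum_subtractf sum_distrib_left)
    also have "\<bar>\<dots>\<bar> \<le> (\<Sum>j<q. B * d ^ 3 / 3)"
      by (intro order_trans[OF sum_abs] sum_mono err) auto
    also have "\<dots> = real q * (B * d ^ 3 / 3)" by simp
    finally have "\<bar>2 * d * (\<Sum>j<q. P c (real (2 * j + 1) * d)) - P I (1/2)\<bar> \<le> real q * (B * d ^ 3 / 3)" .
    then have bound: "2 * real q * \<bar>2 * d * (\<Sum>j<q. P c (real (2 * j + 1) * d)) - P I (1/2)\<bar> \<le> 2 * real q * (real q * (B * d ^ 3 / 3))"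
      by (intro mult_left_mono) auto
    have scaled: "2 * real q * \<bar>2 * d * (\<Sum>j<q. P c (real (2 * j + 1) * d)) - P I (1/2)\<bar> =
        \<bar>(\<Sum>j<q. P c (real (2 * j + 1) * d)) - 2 * real q * P I (1/2)\<bar>"
    proof -
      have "2 * real q * (2 * d * X - Y) = X - 2 * real q * Y" for X Y
        using q by (simp add: d_def field_simps)
      moreover have "2 * real q * \<bar>X\<bar> = \<bar>2 * real q * X\<bar>" for X by (simp add: abs_mult)
      ultimately show ?thesis by metis
    qed
    have const: "2 * real q * (real q * (B * d ^ 3 / 3)) = B / real q / 96"
      using q by (simp add: d_def field_simps eval_nat_numeral)
    have "B / real q / 96 \<le> B / real q"
    proof -
      have "B \<ge> 0" using B[of 0] by force
      have "x / 96 \<le> x" if "x \<ge> 0" for x :: real using that by simp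
      then show ?thesis using \<open>B \<ge> 0\<close> by (metis divide_nonneg_nonneg of_nat_0_le_iff)
    qed
    from order_trans[OF bound[unfolded scaled const] this] show ?thesis by (simp add: d_def)
  qed
  have PI: "P I (1/2) = (\<Sum>k. c k * (1/2) ^ Suc k / real (Suc k))"
  proof -
    have "\<bar>1/2 :: real\<bar> < 1" "I 0 = 0" by (simp_all add: I_def)
    then have "P I (1/2) = (\<Sum>k. I (Suc k) * (1/2) ^ Suc k)"
      using suminf_split_head[OF I[of "1/2"]] by (simp only: P_def)
    then show ?thesis by (simp only: I_def nat.case times_divide_eq_left)
  qed
  show ?thesis
    using main unfolding PI unfolding P_def by blast
qed

section \<open>Asymptotics of the midpoint energy\<close>

definition real_alpha :: "nat \<Rightarrow> real \<Rightarrow> real" where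
  "real_alpha n s = Re (alpha n (of_real s))"

lemma alpha_of_real: "alpha n (of_real s) = of_real (real_alpha n s)"
  unfolding real_alpha_def by (rule alpha_real)

lemma real_alpha_sums:
  assumes y: "0 < y" "y < 1"
  shows "(\<lambda>n. real_alpha n s * y ^ (2 * n)) sums ((sin (pi * y) / (pi * y)) powr (- s))"
proof -
  have "sin (pi * y) > 0" using y by (intro sin_gt_zero) auto
  then have "sinc_neg_power (of_real s) (of_real y) = of_real ((sin (pi * y) / (pi * y)) powr (- s))"
    using y by (simp add: sinc_neg_power_def log_sinc_of_real powr_def exp_of_real[symmetric])
  moreover have "(\<lambda>n. alpha n (of_real s) * of_real y ^ (2 * n)) sums sinc_neg_power (of_real s) (of_real y)"
    using y by (intro alpha_sums) simp
  ultimately have "(\<lambda>n. complex_of_real (real_alpha n s * y ^ (2 * n))) sums of_real ((sin (pi * y) / (pi * y)) powr (- s))"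
    by (simp add: alpha_of_real)
  then show ?thesis by (simp only: sums_of_real_iff)
qed

text \<open>The odd power series \<open>\<Sum>k. \<alpha>\<^sub>m\<^sub>+\<^sub>k y^(2 k + 1)\<close>, as the ordinary power series to which the midpoint rule applies.\<close>

definition tail_coeff :: "real \<Rightarrow> nat \<Rightarrow> nat \<Rightarrow> real" where
  "tail_coeff s m k = (if odd k then real_alpha (m + k div 2) s else 0)"

lemma summable_real_alpha:
  assumes "\<bar>x\<bar> < 1"
  shows "summable (\<lambda>n. real_alpha (m + n) s * (x\<^sup>2) ^ n)"
proof -
  have "norm (complex_of_real (x\<^sup>2)) < 1"
    unfolding norm_of_real using assms by (simp add: abs_square_less_1)
  from sums_summable[OF alpha_powser_sums[OF this, of "of_real s"]]
  have "summable (\<lambda>n. complex_of_real (real_alpha n s * (x\<^sup>2) ^ n))"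
    by (simp add: alpha_of_real)
  then have "summable (\<lambda>n. real_alpha n s * (x\<^sup>2) ^ n)"
    by (simp only: summable_of_real_iff)
  then show ?thesis
    using summable_powser_ignore_initial_segment[of "\<lambda>n. real_alpha n s" m "x\<^sup>2"] by (simp add: add.commute)
qed

lemma tail_coeff_sums:
  assumes "(\<lambda>k. g (2 * k + 1) * real_alpha (m + k) s) sums S"
  shows "(\<lambda>k. g k * tail_coeff s m k) sums (S :: real)"
proof -
  have "(\<lambda>k. g (2 * k + 1) * tail_coeff s m (2 * k + 1)) sums S"
    using assms by (simp add: tail_coeff_def)
  then show ?thesis
    by (subst (asm) sums_mono_reindex) (auto simp: strict_mono_def tail_coeff_def elim!: oddE)
qed

lemma summable_tail_coeff:
  assumes "\<bar>x\<bar> < 1"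
  shows "summable (\<lambda>k. tail_coeff s m k * x ^ k)"
proof -
  have "summable (\<lambda>k. x * (real_alpha (m + k) s * (x\<^sup>2) ^ k))"
    by (intro summable_mult summable_real_alpha assms)
  moreover have "x * (real_alpha (m + k) s * (x\<^sup>2) ^ k) = x ^ (2 * k + 1) * real_alpha (m + k) s" for k
    by (simp flip: power_mult)
  ultimately have "summable (\<lambda>k. x ^ (2 * k + 1) * real_alpha (m + k) s)" by (simp only:)
  from tail_coeff_sums[OF summable_sums[OF this]] show ?thesis
    by (simp add: sums_iff mult.commute)
qed

text \<open>The kernel splits into \<open>M\<close> singular powers, a term \<open>1/y\<close> and a function that is smooth on \<open>[0, 1)\<close>.\<close>

lemma sine_power_expansion:
  fixes M :: nat
  defines "s \<equiv> 2 * real M + 1"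
  assumes y: "0 < y" "y < 1"
  shows "(2 * sin (pi * y)) powr (- s) = (2 * pi) powr (- s) *
    ((\<Sum>n<M. real_alpha n s * y powr (- (s - 2 * real n))) + real_alpha M s * (1 / y)
      + (\<Sum>k. tail_coeff s (Suc M) k * y ^ k))"
proof -
  define f where "f n = real_alpha n s * y ^ (2 * n)" for n
  define R where "R = (\<Sum>k. tail_coeff s (Suc M) k * y ^ k)"
  have pow: "y powr (- s) * y ^ (2 * n) = y powr (- (s - 2 * real n))" for n
    using y by (simp add: powr_add[symmetric] powr_realpow[symmetric])
  have s: "y powr (- s) * y ^ (2 * M + 1) = 1"
  proof -
    have "y ^ (2 * M + 1) = y powr s"
    proof -
      have "s = real (2 * M + 1)" by (simp add: s_def)
      then show ?thesis by (simp only: powr_realpow[OF y(1)])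
    qed
    then show ?thesis using y by (simp add: powr_minus)
  qed
  have f: "f sums ((sin (pi * y) / (pi * y)) powr (- s))"
    unfolding f_def by (rule real_alpha_sums[OF y])
  have "(\<lambda>k. y ^ (2 * k + 1) * real_alpha (Suc M + k) s) sums (\<Sum>k. y * (real_alpha (Suc M + k) s * (y\<^sup>2) ^ k))"
  proof -
    have "\<bar>y\<bar> < 1" using y by simp
    note summable_sums[OF summable_mult[OF summable_real_alpha[OF this, of "Suc M" s], of y]]
    moreover have "y * (real_alpha (Suc M + k) s * (y\<^sup>2) ^ k) = y ^ (2 * k + 1) * real_alpha (Suc M + k) s" for k
      by (simp flip: power_mult)
    ultimately show ?thesis by (simp only:)
  qed
  note S = this
  from tail_coeff_sums[OF this] have R: "R = (\<Sum>k. y * (real_alpha (Suc M + k) s * (y\<^sup>2) ^ k))"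
    by (simp add: R_def sums_iff mult.commute)
  have "(\<lambda>k. y ^ (2 * M + 1) * (y ^ (2 * k + 1) * real_alpha (Suc M + k) s)) sums (y ^ (2 * M + 1) * R)"
    unfolding R by (intro sums_mult S)
  moreover have "y ^ (2 * M + 1) * (y ^ (2 * k + 1) * real_alpha (Suc M + k) s) = f (k + Suc M)" for k
  proof -
    have "y ^ (2 * (k + Suc M)) = y ^ (2 * M + 1) * y ^ (2 * k + 1)"
    proof -
      have "2 * (k + Suc M) = (2 * M + 1) + (2 * k + 1)" by simp
      then show ?thesis by (simp only: power_add)
    qed
    then show ?thesis by (simp add: f_def add.commute power_add)
  qed
  ultimately have "(\<lambda>k. f (k + Suc M)) sums (y ^ (2 * M + 1) * R)" by simp
  then have "f sums (y ^ (2 * M + 1) * R + (\<Sum>n<Suc M. f n))"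
    by (simp only: sums_iff_shift)
  from sums_unique2[OF f this] have eq: "(sin (pi * y) / (pi * y)) powr (- s) = y ^ (2 * M + 1) * R + (\<Sum>n<Suc M. f n)" .
  have "(2 * sin (pi * y)) powr (- s) = (2 * pi * y * (sin (pi * y) / (pi * y))) powr (- s)"
    using y by simp
  also have "\<dots> = (2 * pi) powr (- s) * y powr (- s) * (sin (pi * y) / (pi * y)) powr (- s)"
    by (simp only: powr_mult)
  also have "\<dots> = (2 * pi) powr (- s) * ((y powr (- s) * y ^ (2 * M + 1)) * R + (\<Sum>n<Suc M. y powr (- s) * f n))"
    unfolding eq sum_distrib_left[symmetric] by (simp add: algebra_simps)
  also have "(\<Sum>n<Suc M. y powr (- s) * f n) = (\<Sum>n<Suc M. real_alpha n s * y powr (- (s - 2 * real n)))"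
    by (intro sum.cong refl) (simp only: f_def pow[symmetric] mult.left_commute)
  also have "\<dots> = (\<Sum>n<M. real_alpha n s * y powr (- (s - 2 * real n))) + real_alpha M s * (1 / y)"
    using y by (simp add: s_def powr_minus divide_inverse)
  finally show ?thesis
    unfolding s R_def by (simp add: add_ac)
qed

lemma midpoint_energy_double:
  assumes "q > 0"
  shows "midpoint_energy s (2 * q) = 2 * (\<Sum>j<q. (2 * sin (pi * (real (2 * j + 1) / (4 * real q)))) powr (- s))"
proof -
  define F where "F j = (2 * sin (pi * (2 * real j + 1) / (2 * real (2 * q)))) powr (- s)" for j
  have "midpoint_energy s (2 * q) = (\<Sum>j<q + q. F j)"
    by (simp only: midpoint_energy_def F_def mult_2[of q])
  also have "\<dots> = (\<Sum>j<q. F j) + (\<Sum>j<q. F (q + j))"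
  proof -
    have "(\<Sum>j<q + k. F j) = (\<Sum>j<q. F j) + (\<Sum>j<k. F (q + j))" for k
      by (induction k) (simp_all add: add.assoc)
    then show ?thesis .
  qed
  also have "(\<Sum>j<q. F (q + j)) = (\<Sum>j<q. F (q + (q - Suc j)))"
    by (rule sum.nat_diff_reindex[symmetric])
  also have "\<dots> = (\<Sum>j<q. F j)"
  proof (rule sum.cong)
    fix j assume "j \<in> {..<q}"
    then have "pi * (2 * real (q + (q - Suc j)) + 1) = pi * (2 * real (2 * q)) - pi * (2 * real j + 1)"
      by (simp add: of_nat_diff algebra_simps)
    then have "pi * (2 * real (q + (q - Suc j)) + 1) / (2 * real (2 * q)) = pi - pi * (2 * real j + 1) / (2 * real (2 * q))"
      using assms by (simp only: diff_divide_distrib) simp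
    then show "F (q + (q - Suc j)) = F j"
      by (simp only: F_def sin_pi_minus)
  qed simp
  also have "(\<Sum>j<q. F j) = (\<Sum>j<q. (2 * sin (pi * (real (2 * j + 1) / (4 * real q)))) powr (- s))"
    by (simp add: F_def add.commute)
  finally show ?thesis by simp
qed

text \<open>The finite part, arranged according to this splitting: the primitives of the singular powers at \<open>1/2\<close>, where
  \<open>(1/2)^(1 - p) / (1 - p) = - 2\<^sup>p / (2 (p - 1))\<close>, and the integral of the smooth part.\<close>

lemma finite_part_real:
  fixes M :: nat
  defines "s \<equiv> 2 * real M + 1"
  shows "finite_part M = of_real (- real_alpha M s * ln 2
      - (\<Sum>n<M. real_alpha n s * 2 powr (s - 2 * real n) / (2 * (s - 2 * real n - 1)))
      + (\<Sum>k. tail_coeff s (Suc M) k * (1/2) ^ Suc k / real (Suc k)))"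
proof -
  define f where "f n = 4 ^ M * (real_alpha n s * (1/4) ^ n / (2 * (real n - real M)))" for n
  have s: "of_nat (2 * M + 1) = complex_of_real s" by (simp add: s_def)
  have fc: "complex_of_real (f n) = 4 ^ M * (alpha n (of_nat (2 * M + 1)) * (1/4) ^ n / (2 * (of_nat n - of_nat M)))" for n
    unfolding s alpha_of_real by (simp add: f_def)
  have sm: "summable f"
  proof -
    have "summable (\<lambda>n. complex_of_real (f n))"
      unfolding fc by (intro summable_mult summable_finite_part)
    then show ?thesis by (simp only: summable_of_real_iff)
  qed
  have "4 ^ M * (\<Sum>n. alpha n (of_nat (2 * M + 1)) * (1/4) ^ n / (2 * (of_nat n - of_nat M))) = (\<Sum>n. complex_of_real (f n))"
    unfolding fc by (rule suminf_mult[symmetric, OF summable_finite_part])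
  also have "\<dots> = of_real (suminf f)"
    by (rule suminf_of_real[OF sm, symmetric])
  finally have fp: "finite_part M = of_real (- real_alpha M s * ln 2 + suminf f)"
    unfolding finite_part_def s alpha_of_real by simp
  have split: "suminf f = (\<Sum>n. f (n + Suc M)) + (\<Sum>n<Suc M. f n)"
    by (rule suminf_split_initial_segment[OF sm])
  have head: "(\<Sum>n<Suc M. f n) = - (\<Sum>n<M. real_alpha n s * 2 powr (s - 2 * real n) / (2 * (s - 2 * real n - 1)))"
  proof -
    have "f n = - (real_alpha n s * 2 powr (s - 2 * real n) / (2 * (s - 2 * real n - 1)))" if n: "n < M" for n
    proof -
      define d where "d = real M - real n"
      have "s - 2 * real n = real (2 * (M - n) + 1)"
        using n by (simp add: s_def of_nat_diff)
      then have "2 powr (s - 2 * real n) = (2::real) ^ (2 * (M - n) + 1)"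
        by (simp only: powr_realpow[OF zero_less_numeral])
      also have "\<dots> = 2 * (4 ^ M * (1/4) ^ n)"
        using n by (simp add: power_mult power_diff power_divide)
      finally have 1: "2 powr (s - 2 * real n) = 2 * (4 ^ M * (1/4) ^ n)" .
      have 2: "real n - real M = - d" "s - 2 * real n - 1 = 2 * d" by (simp_all add: d_def s_def)
      show ?thesis unfolding f_def 1 2 by simp
    qed
    moreover have "f M = 0" by (simp add: f_def)
    ultimately show ?thesis by (simp add: sum_negf[symmetric])
  qed
  have tail: "(\<Sum>n. f (n + Suc M)) = (\<Sum>k. tail_coeff s (Suc M) k * (1/2) ^ Suc k / real (Suc k))"
  proof -
    have "f (k + Suc M) = (1/2) ^ Suc (2 * k + 1) / real (Suc (2 * k + 1)) * real_alpha (Suc M + k) s" for k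
    proof -
      have "(1/4::real) ^ (k + Suc M) = (1/4) ^ Suc k * (1/4) ^ M" by (simp add: power_add)
      then have "4 ^ M * (1/4::real) ^ (k + Suc M) = (1/4) ^ Suc k"
        by (simp add: power_divide)
      also have "\<dots> = (1/2) ^ (2 * Suc k)"
        unfolding power_mult by (simp add: power2_eq_square)
      finally have "4 ^ M * (1/4::real) ^ (k + Suc M) = (1/2) ^ Suc (2 * k + 1)" by simp
      moreover have "2 * (real (k + Suc M) - real M) = real (Suc (2 * k + 1))" by simp
      moreover have "f (k + Suc M) = (4 ^ M * (1/4) ^ (k + Suc M)) * real_alpha (k + Suc M) s / (2 * (real (k + Suc M) - real M))"
        by (simp only: f_def) simp
      ultimately show ?thesis by (simp only: add.commute) simp
    qed
    moreover have "summable (\<lambda>k. f (k + Suc M))" using sm by (simp only: summable_iff_shift)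
    ultimately have "(\<lambda>k. (1/2) ^ Suc (2 * k + 1) / real (Suc (2 * k + 1)) * real_alpha (Suc M + k) s) sums (\<Sum>k. f (k + Suc M))"
      by (simp only: summable_sums)
    from tail_coeff_sums[OF this] show ?thesis
      by (simp add: sums_iff mult.commute)
  qed
  show ?thesis
    unfolding fp split head tail by (rule arg_cong[where f = complex_of_real]) linarith
qed


definition leading_coeff :: "nat \<Rightarrow> real" where
  "leading_coeff M = pochhammer (1/2) M / (pi * 2 ^ (2 * M) * fact M)"

text \<open>The logarithm comes from the term \<open>\<alpha>\<^sub>M / y\<close> of the kernel; the closed form of \<open>\<alpha>\<^sub>M(2 M + 1)\<close> gives its coefficient.\<close>

lemma leading_coeff_eq:
  fixes M :: nat
  defines "s \<equiv> 2 * real M + 1"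
  shows "leading_coeff M = 2 * (2 * pi) powr (- s) * real_alpha M s" and "real_alpha M s \<noteq> 0"
proof -
  have "complex_of_real s = of_nat (2 * M + 1)" by (simp add: s_def)
  then have "complex_of_real (real_alpha M s) = of_real (pi ^ (2 * M) * pochhammer (1/2) M / fact M)"
    using alpha_odd[of M] by (simp only: alpha_of_real[symmetric])
  then have ra: "real_alpha M s = pi ^ (2 * M) * pochhammer (1/2) M / fact M"
    by (simp only: of_real_eq_iff)
  show "real_alpha M s \<noteq> 0"
    unfolding ra using pochhammer_pos[of "1/2::real" M] by simp
  have "s = real (2 * M + 1)" by (simp add: s_def)
  moreover have "0 < 2 * pi" by simp
  ultimately have "(2 * pi) powr s = (2 * pi) ^ (2 * M + 1)"
    by (simp only: powr_realpow)
  then have "(2 * pi) powr (- s) = 1 / (2 * pi) ^ (2 * M + 1)"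
    by (simp only: powr_minus_divide)
  also have "(2 * pi) ^ (2 * M + 1) = 2 * pi * (2 ^ (2 * M) * pi ^ (2 * M))"
    by (simp add: power_mult_distrib)
  finally have P: "(2 * pi) powr (- s) = 1 / (2 * pi * (2 ^ (2 * M) * pi ^ (2 * M)))" .
  have "h / (pi * c * f) = 2 * (1 / (2 * pi * (c * b))) * (b * h / f)" if "b \<noteq> 0" for b c f h :: real
    using that by simp
  then show "leading_coeff M = 2 * (2 * pi) powr (- s) * real_alpha M s"
    unfolding ra leading_coeff_def P by (metis pi_neq_zero power_not_zero)
qed

lemma C_real:
  fixes M :: nat
  defines "s \<equiv> 2 * real M + 1"
  shows "C M = of_real (Re (C M))"
    and "finite_part M = of_real (real_alpha M s * (Re (C M) - ln pi))"
proof -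
  define a where "a = real_alpha M s"
  have s: "of_nat (2 * M + 1) = complex_of_real s" by (simp add: s_def)
  have a: "a \<noteq> 0" unfolding a_def s_def by (rule leading_coeff_eq)
  obtain r where "finite_part M = of_real r"
    using finite_part_real[of M] by blast
  then have "of_real r = complex_of_real a * (C M - of_real (ln pi))"
    using finite_part_eq[of M] unfolding s alpha_of_real a_def by simp
  then have "C M - of_real (ln pi) = of_real r / of_real a"
    using a by (simp add: nonzero_eq_divide_eq)
  then have "C M = of_real (r / a + ln pi)"
    by (simp add: diff_eq_eq)
  then show C: "C M = of_real (Re (C M))"
    by (metis Re_complex_of_real)
  show "finite_part M = of_real (real_alpha M s * (Re (C M) - ln pi))"
    using finite_part_eq[of M] unfolding s alpha_of_real by (subst (asm) C) simp
qed

lemma scaled_odd_sum_asymptotic: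
  assumes p: "p > 1" and q: "q > 0"
  shows "\<bar>(\<Sum>j<q. (real (2 * j + 1) / (4 * real q)) powr (- p)) -
      (real_zeta p * (2 powr p - 1) * real (2 * q) powr p - 2 powr p / (2 * (p - 1)) * real (2 * q))\<bar>
    \<le> 4 powr p * (p * (p + 1)) / real q"
proof -
  define X where "X = (\<Sum>j<q. real (2 * j + 1) powr (- p))"
  define Y where "Y = (1 - 2 powr (- p)) * real_zeta p - (2 * real q) powr (1 - p) / (2 * (p - 1))"
  have "(\<Sum>j<q. (real (2 * j + 1) / (4 * real q)) powr (- p)) = (4 * real q) powr p * X"
    unfolding X_def sum_distrib_left
    by (intro sum.cong refl) (simp only: powr_divide powr_minus inverse_eq_divide divide_divide_eq_right, simp)
  moreover have "(4 * real q) powr p * Y =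
      real_zeta p * (2 powr p - 1) * real (2 * q) powr p - 2 powr p / (2 * (p - 1)) * real (2 * q)"
  proof -
    have 1: "(4 * real q) powr p = 2 powr p * real (2 * q) powr p"
      by (simp only: powr_mult[symmetric]) simp
    have 2: "2 powr p * (1 - 2 powr (- p)) = 2 powr p - (1::real)"
      by (simp add: right_diff_distrib powr_add[symmetric])
    have 3: "real (2 * q) powr p * (2 * real q) powr (1 - p) = real (2 * q)"
      using q by (simp add: powr_add[symmetric])
    have "(4 * real q) powr p * Y = (2 powr p * (1 - 2 powr (- p))) * real_zeta p * real (2 * q) powr p
        - 2 powr p / (2 * (p - 1)) * (real (2 * q) powr p * (2 * real q) powr (1 - p))"
      unfolding 1 Y_def by (simp add: algebra_simps)
    then show ?thesis unfolding 2 3 by (simp add: mult_ac)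
  qed
  moreover have "\<bar>(4 * real q) powr p * X - (4 * real q) powr p * Y\<bar> \<le> 4 powr p * (p * (p + 1)) / real q"
  proof -
    have "\<bar>(4 * real q) powr p * X - (4 * real q) powr p * Y\<bar> = (4 * real q) powr p * \<bar>X - Y\<bar>"
      by (simp add: abs_mult right_diff_distrib[symmetric])
    also have "\<dots> \<le> (4 * real q) powr p * (p * (p + 1) * real q powr (- p - 1))"
      unfolding X_def Y_def by (intro mult_left_mono sum_odd_powr_asymptotic p q) simp
    also have "\<dots> = 4 powr p * (p * (p + 1)) * (real q powr p * real q powr (- p - 1))"
      by (simp add: powr_mult)
    also have "real q powr p * real q powr (- p - 1) = 1 / real q"
      using q by (simp add: powr_add[symmetric] powr_minus_divide)
    finally show ?thesis by simp
  qed
  ultimately show ?thesis by simp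
qed

lemma scaled_odd_reciprocal_sum_asymptotic:
  assumes q: "q > 0"
  shows "\<bar>(\<Sum>j<q. 1 / (real (2 * j + 1) / (4 * real q))) -
      real (2 * q) * (ln (real (2 * q)) + euler_mascheroni + ln 2)\<bar> \<le> 4 / real q"
proof -
  define X where "X = (\<Sum>j<q. 1 / real (2 * j + 1))"
  define Y where "Y = ln (real q) / 2 + ln 2 + euler_mascheroni / 2"
  have "(\<Sum>j<q. 1 / (real (2 * j + 1) / (4 * real q))) = 4 * real q * X"
    unfolding X_def sum_distrib_left by (intro sum.cong) simp_all
  moreover have "real (2 * q) * (ln (real (2 * q)) + euler_mascheroni + ln 2) = 4 * real q * Y"
    using q by (simp add: Y_def ln_mult algebra_simps)
  moreover have "\<bar>4 * real q * X - 4 * real q * Y\<bar> \<le> 4 / real q"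
  proof -
    have "\<bar>4 * real q * X - 4 * real q * Y\<bar> = 4 * real q * \<bar>X - Y\<bar>"
      by (simp add: abs_mult right_diff_distrib[symmetric])
    also have "\<dots> \<le> 4 * real q * (1 / (real q)\<^sup>2)"
      unfolding X_def Y_def by (intro mult_left_mono sum_odd_reciprocal_asymptotic q) simp
    finally show ?thesis using q by (simp add: power2_eq_square)
  qed
  ultimately show ?thesis by (simp only:)
qed

text \<open>The share of one binary digit \<open>x\<close> of \<open>N\<close> in the asymptotic formula.\<close>

definition main_part :: "nat \<Rightarrow> real \<Rightarrow> real" where
  "main_part M x = leading_coeff M * (x * ln x)
     + leading_coeff M * (euler_mascheroni + ln (4 / pi) + Re (C M)) * x
     + 2 / (2 * pi) powr (2 * real M + 1) *
       (\<Sum>n<M. real_alpha n (2 * real M + 1) * real_zeta (2 * real M + 1 - 2 * real n)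
          * (2 powr (2 * real M + 1 - 2 * real n) - 1) * x powr (2 * real M + 1 - 2 * real n))"

text \<open>The coefficients of \<open>x = 2 q\<close> produced by the tails of the zeta series, by the logarithm and by the
  integral of the smooth part combine into the finite part of the integral; this is where \<open>C M\<close> enters.\<close>

lemma midpoint_energy_even_asymptotic:
  fixes M :: nat
  defines "s \<equiv> 2 * real M + 1"
  shows "\<exists>K. \<forall>q>0. \<bar>midpoint_energy s (2 * q) - main_part M (real (2 * q))\<bar> \<le> K / real q"
proof -
  define P where "P = (2 * pi) powr (- s)"
  define p where "p n = s - 2 * real n" for n
  define y where "y q j = real (2 * j + 1) / (4 * real q)" for q j :: nat
  define R where "R = (\<Sum>k. tail_coeff s (Suc M) k * (1/2) ^ Suc k / real (Suc k))"
  obtain B where B: "\<forall>q>0. \<bar>(\<Sum>j<q. \<Sum>k. tail_coeff s (Suc M) k * (real (2 * j + 1) / (4 * real q)) ^ k)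
      - 2 * real q * R\<bar> \<le> B / real q"
    using powser_midpoint_sums[of "tail_coeff s (Suc M)", OF summable_tail_coeff] unfolding R_def by blast
  define L where "L n = real_zeta (p n) * (2 powr p n - 1)" for n
  define L' where "L' n = 2 powr p n / (2 * (p n - 1))" for n
  define K where "K = (\<Sum>n<M. \<bar>real_alpha n s\<bar> * (4 powr p n * (p n * (p n + 1)))) + \<bar>real_alpha M s\<bar> * 4 + B"
  \<comment> \<open>The integral of the smooth part, solved for from the value of the finite part.\<close>
  have R: "R = real_alpha M s * (Re (C M) - ln pi) + real_alpha M s * ln 2 + (\<Sum>n<M. real_alpha n s * L' n)"
  proof -
    have "finite_part M = of_real (- real_alpha M s * ln 2 - (\<Sum>n<M. real_alpha n s * L' n) + R)"
      unfolding R_def L'_def p_def s_def using finite_part_real[of M] by simp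
    then have "- real_alpha M s * ln 2 - (\<Sum>n<M. real_alpha n s * L' n) + R = real_alpha M s * (Re (C M) - ln pi)"
      using C_real(2)[of M] unfolding s_def of_real_eq_iff[symmetric, where 'a = complex] by simp
    then show ?thesis by linarith
  qed
  have P: "leading_coeff M = 2 * P * real_alpha M s"
    unfolding P_def s_def by (rule leading_coeff_eq)
  have main: "main_part M x = 2 * P * ((\<Sum>n<M. real_alpha n s * (L n * x powr p n - L' n * x))
       + real_alpha M s * (x * (ln x + euler_mascheroni + ln 2)) + x * R)" if "x > 0" for x
  proof -
    define S where "S = (\<Sum>n<M. real_alpha n s * L n * x powr p n)"
    define T where "T = (\<Sum>n<M. real_alpha n s * L' n)"
    have sum: "(\<Sum>n<M. real_alpha n s * (L n * x powr p n - L' n * x)) = S - x * T"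
      unfolding S_def T_def sum_distrib_left sum_subtractf[symmetric]
      by (intro sum.cong refl) (simp only: right_diff_distrib mult_ac)
    have P': "2 / (2 * pi) powr s = 2 * P" by (simp add: P_def powr_minus divide_inverse)
    have ln: "ln (4 / pi) = ln 2 + ln 2 - ln pi"
      using ln_mult[of 2 "2::real"] by (simp add: ln_div)
    have "main_part M x = leading_coeff M * (x * ln x)
        + leading_coeff M * (euler_mascheroni + ln (4 / pi) + Re (C M)) * x + 2 / (2 * pi) powr s * S"
      unfolding main_part_def S_def L_def p_def s_def[symmetric] by (simp only: mult.assoc)
    then show ?thesis
      unfolding sum P' ln P R T_def[symmetric] by (simp add: algebra_simps)
  qed
  have "\<bar>midpoint_energy s (2 * q) - main_part M (real (2 * q))\<bar> \<le> 2 * P * K / real q" if q: "q > 0" for q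
  proof -
    define x where "x = real (2 * q)"
    define E1 where "E1 n = (\<Sum>j<q. y q j powr (- p n)) - (L n * x powr p n - L' n * x)" for n
    define E2 where "E2 = (\<Sum>j<q. 1 / y q j) - x * (ln x + euler_mascheroni + ln 2)"
    define E3 where "E3 = (\<Sum>j<q. \<Sum>k. tail_coeff s (Suc M) k * y q j ^ k) - x * R"
    have E1: "\<bar>E1 n\<bar> \<le> 4 powr p n * (p n * (p n + 1)) / real q" if "n < M" for n
    proof -
      have "real n + 1 \<le> real M" using that by linarith
      then have "p n > 1" by (simp add: p_def s_def)
      from scaled_odd_sum_asymptotic[OF this q] show ?thesis
        by (simp only: E1_def y_def L_def L'_def x_def)
    qed
    have E2: "\<bar>E2\<bar> \<le> 4 / real q"
      using scaled_odd_reciprocal_sum_asymptotic[OF q] by (simp only: E2_def y_def x_def)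
    have E3: "\<bar>E3\<bar> \<le> B / real q"
      using B q by (simp add: E3_def x_def y_def)
    have "midpoint_energy s (2 * q) = 2 * (\<Sum>j<q. P * ((\<Sum>n<M. real_alpha n s * y q j powr (- p n))
         + real_alpha M s * (1 / y q j) + (\<Sum>k. tail_coeff s (Suc M) k * y q j ^ k)))"
    proof -
      have "(2 * sin (pi * y q j)) powr (- s) = P * ((\<Sum>n<M. real_alpha n s * y q j powr (- p n))
         + real_alpha M s * (1 / y q j) + (\<Sum>k. tail_coeff s (Suc M) k * y q j ^ k))" if "j < q" for j
      proof -
        have "0 < y q j" "y q j < 1" using that by (simp_all add: y_def)
        from sine_power_expansion[OF this, of M] show ?thesis
          by (simp only: P_def p_def s_def)
      qed
      then show ?thesis
        unfolding midpoint_energy_double[OF q] y_def by simp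
    qed
    also have "\<dots> = 2 * P * ((\<Sum>n<M. real_alpha n s * (\<Sum>j<q. y q j powr (- p n)))
         + real_alpha M s * (\<Sum>j<q. 1 / y q j) + (\<Sum>j<q. \<Sum>k. tail_coeff s (Suc M) k * y q j ^ k))"
    proof -
      have "(\<Sum>n<M. real_alpha n s * (\<Sum>j<q. y q j powr (- p n))) = (\<Sum>j<q. \<Sum>n<M. real_alpha n s * y q j powr (- p n))"
        unfolding sum_distrib_left by (rule sum.swap)
      then show ?thesis
        by (simp only: sum_distrib_left[symmetric] sum.distrib mult.assoc)
    qed
    finally have energy: "midpoint_energy s (2 * q) = 2 * P * ((\<Sum>n<M. real_alpha n s * (\<Sum>j<q. y q j powr (- p n)))
         + real_alpha M s * (\<Sum>j<q. 1 / y q j) + (\<Sum>j<q. \<Sum>k. tail_coeff s (Suc M) k * y q j ^ k))" .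
    have sum_E1: "(\<Sum>n<M. real_alpha n s * E1 n) = (\<Sum>n<M. real_alpha n s * (\<Sum>j<q. y q j powr (- p n)))
        - (\<Sum>n<M. real_alpha n s * (L n * x powr p n - L' n * x))"
      by (simp only: E1_def right_diff_distrib[of "real_alpha _ s" "sum _ _"] sum_subtractf)
    have "x > 0" using q by (simp add: x_def)
    have "midpoint_energy s (2 * q) - main_part M x = 2 * P * ((\<Sum>n<M. real_alpha n s * E1 n) + real_alpha M s * E2 + E3)"
      unfolding energy main[OF \<open>x > 0\<close>] sum_E1 E2_def E3_def
      unfolding right_diff_distrib[of "2 * P", symmetric] right_diff_distrib[of "real_alpha M s"] by simp
    also have "\<bar>\<dots>\<bar> = 2 * P * \<bar>(\<Sum>n<M. real_alpha n s * E1 n) + real_alpha M s * E2 + E3\<bar>"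
      by (simp add: abs_mult P_def)
    also have "\<dots> \<le> 2 * P * (K / real q)"
    proof (rule mult_left_mono)
      have "\<bar>\<Sum>n<M. real_alpha n s * E1 n\<bar> \<le> (\<Sum>n<M. \<bar>real_alpha n s\<bar> * (4 powr p n * (p n * (p n + 1)) / real q))"
      proof (rule order_trans[OF sum_abs], rule sum_mono)
        fix n assume "n \<in> {..<M}"
        then show "\<bar>real_alpha n s * E1 n\<bar> \<le> \<bar>real_alpha n s\<bar> * (4 powr p n * (p n * (p n + 1)) / real q)"
          unfolding abs_mult by (intro mult_left_mono E1) auto
      qed
      moreover have "\<bar>real_alpha M s * E2\<bar> \<le> \<bar>real_alpha M s\<bar> * (4 / real q)"
        unfolding abs_mult by (intro mult_left_mono E2) simp
      moreover have "K / real q = (\<Sum>n<M. \<bar>real_alpha n s\<bar> * (4 powr p n * (p n * (p n + 1)) / real q))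
          + \<bar>real_alpha M s\<bar> * (4 / real q) + B / real q"
        by (simp add: K_def add_divide_distrib sum_divide_distrib)
      ultimately show "\<bar>(\<Sum>n<M. real_alpha n s * E1 n) + real_alpha M s * E2 + E3\<bar> \<le> K / real q"
        using E3 by linarith
    qed (simp add: P_def)
    finally show ?thesis by (simp add: x_def)
  qed
  then show ?thesis by blast
qed

lemma midpoint_energy_power_of_2_asymptotic:
  "\<exists>K. \<forall>i. \<bar>midpoint_energy (2 * real M + 1) (2 ^ i) - main_part M (2 ^ i)\<bar> \<le> K * (1/2) ^ i"
proof -
  define D where "D m = \<bar>midpoint_energy (2 * real M + 1) m - main_part M (real m)\<bar>" for m :: nat
  obtain K where K: "\<And>q. q > 0 \<Longrightarrow> D (2 * q) \<le> K / real q"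
    using midpoint_energy_even_asymptotic[of M] unfolding D_def by blast
  have "D (2 ^ i) \<le> max (D 1) (2 * K) * (1/2) ^ i" for i
  proof (cases i)
    case (Suc k)
    have "D (2 ^ i) \<le> K / real (2 ^ k)"
      using K[of "2 ^ k"] by (simp add: Suc)
    also have "\<dots> = 2 * K * (1/2) ^ i"
      by (simp add: Suc power_divide)
    also have "\<dots> \<le> max (D 1) (2 * K) * (1/2) ^ i"
      by (intro mult_right_mono) auto
    finally show ?thesis .
  qed simp
  then show ?thesis
    unfolding D_def by (intro exI[of _ "max (D 1) (2 * K)"]) (simp add: D_def)
qed



section \<open>Summation over the binary digits\<close>

lemma sum_list_eta: "(\<Sum>x\<leftarrow>eta N. h x) = (\<Sum>i\<in>set_decode N. h (2 ^ i / real N))"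
  by (simp add: eta_def binary_exponents_def rev_map[symmetric] sum_list_distinct_conv_sum_set o_def)

lemma sum_set_decode: "(\<Sum>i\<in>set_decode N. 2 ^ i :: real) = real N"
proof -
  have "(\<Sum>i\<in>set_decode N. 2 ^ i) = N"
    using set_decode_inverse[of N] by (simp add: set_encode_def)
  then have "real (\<Sum>i\<in>set_decode N. 2 ^ i) = real N" by (rule arg_cong)
  then show ?thesis by simp
qed

text \<open>Summation over the digits turns powers into \<open>G\<close>, and \<open>x ln x\<close> into \<open>N ln N\<close> plus the entropy term
  \<open>Lam (eta N) N\<close>, because the digits add up to \<open>N\<close>.\<close>

lemma sum_binary_main_part:
  fixes M N :: nat
  defines "s \<equiv> 2 * real M + 1"
  assumes N: "N \<ge> 1"
  shows "(\<Sum>i\<in>set_decode N. main_part M (2 ^ i)) =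
      leading_coeff M * real N * ln (real N)
      + leading_coeff M * (euler_mascheroni + ln (4 / pi) + Re (C M) + Lam (eta N)) * real N
      + 2 / (2 * pi) powr s * (\<Sum>n<M. real_alpha n s * real_zeta (s - 2 * real n)
          * ((2 powr (s - 2 * real n) - 1) * G (eta N) (s - 2 * real n) * real N powr (s - 2 * real n)))"
proof -
  define D where "D = set_decode N"
  have pow: "(\<Sum>i\<in>D. (2 ^ i) powr t) = G (eta N) t * real N powr t" for t
  proof -
    have "(\<Sum>i\<in>D. (2 ^ i) powr t) = (\<Sum>i\<in>D. (2 ^ i / real N) powr t * real N powr t)"
      using N by (intro sum.cong refl) (simp flip: powr_mult)
    then show ?thesis
      by (simp add: G_def sum_list_eta D_def sum_distrib_right)
  qed
  have entropy: "(\<Sum>i\<in>D. 2 ^ i * ln (2 ^ i)) = real N * ln (real N) + Lam (eta N) * real N"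
  proof -
    have "2 ^ i * ln (2 ^ i) = 2 ^ i * ln (real N) + 2 ^ i / real N * ln (2 ^ i / real N) * real N" for i :: nat
    proof -
      have ln: "ln (2 ^ i) = ln (real N) + ln (2 ^ i / real N)"
        using N by (simp add: ln_div)
      have cancel: "2 ^ i / real N * l * real N = 2 ^ i * l" for l :: real
        using N by simp
      show ?thesis
        unfolding cancel by (subst ln) (rule distrib_left)
    qed
    then have "(\<Sum>i\<in>D. 2 ^ i * ln (2 ^ i)) =
        (\<Sum>i\<in>D. 2 ^ i) * ln (real N) + (\<Sum>i\<in>D. 2 ^ i / real N * ln (2 ^ i / real N)) * real N"
      by (simp only: sum.distrib sum_distrib_right)
    then show ?thesis
      unfolding D_def sum_set_decode Lam_def sum_list_eta .
  qed
  have "(\<Sum>i\<in>D. main_part M (2 ^ i)) = leading_coeff M * (\<Sum>i\<in>D. 2 ^ i * ln (2 ^ i))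
      + leading_coeff M * (euler_mascheroni + ln (4 / pi) + Re (C M)) * (\<Sum>i\<in>D. 2 ^ i)
      + 2 / (2 * pi) powr s * (\<Sum>i\<in>D. \<Sum>n<M. real_alpha n s * real_zeta (s - 2 * real n)
          * (2 powr (s - 2 * real n) - 1) * (2 ^ i) powr (s - 2 * real n))"
    unfolding main_part_def s_def[symmetric] sum.distrib sum_distrib_left[symmetric] ..
  also have "(\<Sum>i\<in>D. \<Sum>n<M. real_alpha n s * real_zeta (s - 2 * real n)
          * (2 powr (s - 2 * real n) - 1) * (2 ^ i) powr (s - 2 * real n)) =
      (\<Sum>n<M. real_alpha n s * real_zeta (s - 2 * real n)
          * ((2 powr (s - 2 * real n) - 1) * G (eta N) (s - 2 * real n) * real N powr (s - 2 * real n)))"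
    by (subst sum.swap) (simp only: sum_distrib_left[symmetric] pow mult.assoc)
  also have "(\<Sum>i\<in>D. 2 ^ i :: real) = real N"
    unfolding D_def by (rule sum_set_decode)
  finally show ?thesis
    unfolding entropy unfolding D_def by (simp add: algebra_simps)
qed

lemma sum_half_powers_le: "finite D \<Longrightarrow> (\<Sum>i\<in>D. (1/2) ^ i :: real) \<le> 2"
  using sum_le_suminf[of "\<lambda>i. (1/2::real) ^ i" D] by (simp add: suminf_geometric)

theorem theorem1p5:
  fixes M :: nat and s :: real and a :: "nat \<Rightarrow> complex"
  assumes "s = 2 * real M + 1"
    and "greedy_energy_sequence s a"
  shows "\<exists>H :: nat \<Rightarrow> real. bounded (H ` {1..}) \<and>
    (\<forall>N\<ge>1. \<exists>u :: real. potential s a N (a N) = ereal u \<and>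
      complex_of_real u =
        of_real (pochhammer (1/2) M / (pi * 2 ^ (2 * M) * fact M) * real N * ln (real N))
      + of_real (pochhammer (1/2) M / (pi * 2 ^ (2 * M) * fact M))
          * (of_real (euler_mascheroni + ln (4 / pi)) + C M + of_real (Lam (eta N))) * of_nat N
      + of_real (2 / (2 * pi) powr s)
          * (\<Sum>j<M. alpha j (of_real s) * zeta (of_real (s - 2 * real j))
              * of_real ((2 powr (s - 2 * real j) - 1) * G (eta N) (s - 2 * real j)
                         * real N powr (s - 2 * real j)))
      + of_real (H N))"
proof -
  define u where "u N = (\<Sum>i\<in>set_decode N. midpoint_energy s (2 ^ i))" for N
  define H where "H N = (\<Sum>i\<in>set_decode N. midpoint_energy s (2 ^ i) - main_part M (2 ^ i))" for N
  obtain K where K: "\<And>i. \<bar>midpoint_energy s (2 ^ i) - main_part M (2 ^ i)\<bar> \<le> K * (1/2) ^ i"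
    using midpoint_energy_power_of_2_asymptotic[of M] unfolding assms(1) by blast
  have "K \<ge> 0" using order_trans[OF abs_ge_zero K[of 0]] by simp
  have "\<bar>H N\<bar> \<le> K * 2" for N
  proof -
    have "\<bar>H N\<bar> \<le> (\<Sum>i\<in>set_decode N. K * (1/2) ^ i)"
      unfolding H_def by (intro order_trans[OF sum_abs] sum_mono K)
    also have "\<dots> = K * (\<Sum>i\<in>set_decode N. (1/2) ^ i)"
      by (rule sum_distrib_left[symmetric])
    also have "\<dots> \<le> K * 2"
      using \<open>K \<ge> 0\<close> by (intro mult_left_mono sum_half_powers_le) auto
    finally show ?thesis .
  qed
  then have "bounded (H ` {1..})"
    unfolding bounded_iff by (intro exI[of _ "K * 2"]) auto
  moreover have "potential s a N (a N) = ereal (u N) \<and>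
      complex_of_real (u N) =
        of_real (pochhammer (1/2) M / (pi * 2 ^ (2 * M) * fact M) * real N * ln (real N))
      + of_real (pochhammer (1/2) M / (pi * 2 ^ (2 * M) * fact M))
          * (of_real (euler_mascheroni + ln (4 / pi)) + C M + of_real (Lam (eta N))) * of_nat N
      + of_real (2 / (2 * pi) powr s)
          * (\<Sum>j<M. alpha j (of_real s) * zeta (of_real (s - 2 * real j))
              * of_real ((2 powr (s - 2 * real j) - 1) * G (eta N) (s - 2 * real j)
                         * real N powr (s - 2 * real j)))
      + of_real (H N)" if N: "N \<ge> 1" for N
  proof
    have "s > 0" using assms(1) by simp
    then show "potential s a N (a N) = ereal (u N)"
      unfolding u_def using assms(2) N by (rule greedy_potential_eq)
    have zeta: "zeta (of_real (s - 2 * real j)) = of_real (real_zeta (s - 2 * real j))" if "j < M" for j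
    proof (rule zeta_of_real)
      have "real j + 1 \<le> real M" using that by linarith
      then show "s - 2 * real j > 1" by (simp add: assms(1))
    qed
    have sum: "(\<Sum>j<M. alpha j (of_real s) * zeta (of_real (s - 2 * real j))
              * of_real ((2 powr (s - 2 * real j) - 1) * G (eta N) (s - 2 * real j)
                         * real N powr (s - 2 * real j))) =
        complex_of_real (\<Sum>n<M. real_alpha n s * real_zeta (s - 2 * real n)
          * ((2 powr (s - 2 * real n) - 1) * G (eta N) (s - 2 * real n) * real N powr (s - 2 * real n)))"
      unfolding of_real_sum by (intro sum.cong refl) (simp only: zeta alpha_of_real lessThan_iff of_real_mult)
    have "u N = (\<Sum>i\<in>set_decode N. main_part M (2 ^ i)) + H N"
      by (simp add: u_def H_def sum_subtractf)
    then have "complex_of_real (u N) = of_real ((\<Sum>i\<in>set_decode N. main_part M (2 ^ i)) + H N)"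
      by (rule arg_cong)
    then show "complex_of_real (u N) =
        of_real (pochhammer (1/2) M / (pi * 2 ^ (2 * M) * fact M) * real N * ln (real N))
      + of_real (pochhammer (1/2) M / (pi * 2 ^ (2 * M) * fact M))
          * (of_real (euler_mascheroni + ln (4 / pi)) + C M + of_real (Lam (eta N))) * of_nat N
      + of_real (2 / (2 * pi) powr s)
          * (\<Sum>j<M. alpha j (of_real s) * zeta (of_real (s - 2 * real j))
              * of_real ((2 powr (s - 2 * real j) - 1) * G (eta N) (s - 2 * real j)
                         * real N powr (s - 2 * real j)))
      + of_real (H N)"
      unfolding sum sum_binary_main_part[OF N] assms(1)[symmetric] leading_coeff_def[symmetric]
      by (subst C_real(1)) (simp only: of_real_add of_real_mult of_real_of_nat_eq)
  qed
  ultimately show ?thesis by blast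
qed

end
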